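(* Let $(A_n)_{n\in\mathbb{N}}$ be a sequence of finite non-empty subsets of the Ulam-Harris-Neveu tree $\mathbb{T}^\infty$, and for each $n$ let $U_n,V_n$ be independent and uniformly distributed on $A_n$. Assume that for all $k\in\mathbb{N}$, $$\mathbb{P}(d(U_n,V_n)\le k)=|A_n|^{-2}\sum_{u,v\in A_n}\mathbf{1}_{\{d(u,v)\le k\}}\longrightarrow 0\quad\text{as } n\to\infty .$$ Let $X$ be a branching Markov process on $\mathbb{T}^\infty$ with values in a metric space $\mathcal{X}$, with transition kernel $Q$ and initial distribution $\nu$. Let $f$ be a real-valued Borel function on $\mathcal{X}$ such that: (1) $\sup_{n\in\mathbb{N}}\nu Q^n(f^2)<\infty$; (2) there exists a constant $c_f\in\mathbb{R}$ such that $\lim_{n\to\infty}\nu Q^k\bigl((Q^nf-c_f)^2\bigr)=0$ for all $k\in\mathbb{N}$. Assume furthermore that at least one of the following conditions (A), (B) holds: (A) the sequence of random variables $(h(U_n\wedge V_n))_{n\in\mathbb{N}}$ is tight, that is, for every $\varepsilon>0$ there exists $k\in\mathbb{N}$ such that $\mathbb{P}(h(U_n\wedge V_n)>k)<\varepsilon$ for all $n$ large enough; (B) any one of the following holds: (i) $\nu=\mu$ is an invariant measure of $Q$; (ii) $\lim_{n\to\infty}\|\nu Q^n-\mu\|_{\mathrm{TV}}=0$ for some invariant measure $\mu$ of $Q$, the function $f$ is bounded, and $\lim_{n\to\infty}\mu\bigl((Q^nf-c_f)^2\bigr)=0$ with the same constant $c_f$ as in (2); (iii) $Q$ has a unique invariant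 measure $\mu$, and there exist a non-negative Borel function $g$ on $\mathcal{X}$ with $\sup_{k\in\mathbb{N}}\nu Q^k(g^2)<\infty$ and a sequence of positive numbers $(a_n)_{n\in\mathbb{N}}$ converging to $0$ such that $|Q^nf-\langle\mu,f\rangle|\le a_n\,g$ for all $n\in\mathbb{N}$. Then $$\bar M_{A_n}(f)=|A_n|^{-1}\sum_{u\in A_n}f(X_u)\longrightarrow c_f\quad\text{in } L^2(\nu)\text{ as } n\to\infty ,$$ where $L^2(\nu)$ means $L^2$ with respect to the law of the process $X$ with initial distribution $\nu$.
   Context: $\mathbb{T}^\infty=\bigcup_{n\in\mathbb{N}}(\mathbb{N}^* )^n$ is the Ulam-Harris-Neveu tree, with root $\partial$ the empty word; the parent $\mathrm{p}(u)$ of a non-root vertex $u$ is obtained by deleting its last letter. $h(u)$ is the height of $u$ (number of edges between $u$ and $\partial$), $u\wedge v$ is the latest common ancestor of $u$ and $v$, and $d(u,v)=h(u)+h(v)-2h(u\wedge v)$ is the graph distance. $|A|$ denotes the cardinality of $A$. A stochastic process $X=(X_u,u\in\mathbb{T}^\infty)$ with values in a metric space $\mathcal{X}$ (with its Borel $\sigma$-field) is a branching Markov process with (Markov) transition kernel $Q$ and initial distribution $\nu$ (a probability measure on $\mathcal{X}$) if for every finite subtree $T\subset\mathbb{T}^\infty$ with $\partial\in T$, $$\mathbb{P}\Bigl(\bigcap_{u\in T}\{X_u\in \mathrm{d}x_u\}\Bigr)=\nu(\mathrm{d}x_\partial)\prod_{u\in T\setminus\{\partial\}}Q(x_{\mathrm{p}(u)};\mathrm{d}x_u).$$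 $Qf(x)=\int f(y)\,Q(x;\mathrm{d}y)$ whenever this makes sense, $\nu Q^n$ is the distribution of $X_u$ for $u$ in the $n$-th generation, and $\mu f=\langle\mu,f\rangle=\int f\,\mathrm{d}\mu$. Condition (1) implies that for all $k,n,m\in\mathbb{N}$ the functions $Q^nf$, $Q^n(f^2)$ and $Q^k(Q^nf\times Q^mf)$ are well defined and finite $\nu$-almost everywhere and $\nu$-integrable. Invariant measures are understood to be probability measures. *)

theory Defs
  imports "HOL-Probability.Probability" "HOL-Library.Sublist"
begin

section \<open>The Ulam-Harris-Neveu tree\<close>

definition UHN :: "nat list set" where
  "UHN = lists {1..}"

definition parent :: "nat list \<Rightarrow> nat list" where
  "parent u = butlast u"

definition tree_height :: "nat list \<Rightarrow> nat" where
  "tree_height u = length u"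

definition common_ancestor :: "nat list \<Rightarrow> nat list \<Rightarrow> nat list" where
  "common_ancestor u v = longest_common_prefix u v"

(* The subtraction on nat does not truncate, since the common ancestor is a prefix of u and v. *)
definition tree_dist :: "nat list \<Rightarrow> nat list \<Rightarrow> nat" where
  "tree_dist u v = tree_height u + tree_height v - 2 * tree_height (common_ancestor u v)"

(* A subset of UHN containing the root is connected iff it is closed under parents. *)
definition finite_rooted_subtree :: "nat list set \<Rightarrow> bool" where
  "finite_rooted_subtree T \<longleftrightarrow>
     finite T \<and> T \<subseteq> UHN \<and> [] \<in> T \<and> (\<forall>u\<in>T - {[]}. parent u \<in> T)"

(* Joint law of two independent vertices, each uniform on the finite non-empty set A. *)
definition uniform_pair :: "nat list set \<Rightarrow> (nat list \<times> nat list) pmf" where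
  "uniform_pair A = pair_pmf (pmf_of_set A) (pmf_of_set A)"

section \<open>Markov kernels\<close>

definition markov_kernel :: "('x::metric_space \<Rightarrow> 'x measure) \<Rightarrow> bool" where
  "markov_kernel Q \<longleftrightarrow> Q \<in> borel \<rightarrow>\<^sub>M prob_algebra borel"

definition borel_prob :: "'x::metric_space measure \<Rightarrow> bool" where
  "borel_prob \<mu> \<longleftrightarrow> prob_space \<mu> \<and> sets \<mu> = sets borel"

definition measure_iter :: "('x \<Rightarrow> 'x measure) \<Rightarrow> nat \<Rightarrow> 'x measure \<Rightarrow> 'x measure" where
  "measure_iter Q n \<mu> = ((\<lambda>m. m \<bind> Q) ^^ n) \<mu>"

(* Q^n(x; .) as the law after n steps started from the Dirac mass at x *)
definition kernel_pow :: "('x::metric_space \<Rightarrow> 'x measure) \<Rightarrow> nat \<Rightarrow> 'x \<Rightarrow> 'x measure" where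
  "kernel_pow Q n x = measure_iter Q n (return borel x)"

(* The Bochner integral is 0 at points x where f is not Q^n(x; .)-integrable. *)
definition kernel_fun :: "('x::metric_space \<Rightarrow> 'x measure) \<Rightarrow> nat \<Rightarrow> ('x \<Rightarrow> real) \<Rightarrow> 'x \<Rightarrow> real" where
  "kernel_fun Q n f x = (\<integral>y. f y \<partial>kernel_pow Q n x)"

definition invariant_measure :: "('x::metric_space \<Rightarrow> 'x measure) \<Rightarrow> 'x measure \<Rightarrow> bool" where
  "invariant_measure Q \<mu> \<longleftrightarrow> borel_prob \<mu> \<and> \<mu> \<bind> Q = \<mu>"

(* For probability measures, half the total mass of the variation of their difference. *)
definition tv_dist :: "'x::metric_space measure \<Rightarrow> 'x measure \<Rightarrow> real" where
  "tv_dist \<mu> \<nu> = (SUP B\<in>sets borel. \<bar>measure \<mu> B - measure \<nu> B\<bar>)"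

section \<open>Branching Markov processes\<close>

(* For us = [u1, ..., um], the iterated integral
     INT Q(x (parent u1); dx_u1) ... INT Q(x (parent um); dx_um) F(x),
   where the coordinates of x outside us are kept. *)
fun tree_integral ::
  "('x \<Rightarrow> 'x measure) \<Rightarrow> nat list list \<Rightarrow> ((nat list \<Rightarrow> 'x) \<Rightarrow> ennreal) \<Rightarrow> (nat list \<Rightarrow> 'x) \<Rightarrow> ennreal"
where
  "tree_integral Q [] F x = F x"
| "tree_integral Q (u # us) F x = (\<integral>\<^sup>+ y. tree_integral Q us F (x(u := y)) \<partial>Q (x (parent u)))"

(* Enumerations of the non-root vertices of T in which no vertex comes before its parent: the orders
   in which the kernels in the finite-dimensional law on T can be integrated out.  By Tonelli the
   value of the iterated integral does not depend on the enumeration. *)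
definition genealogical_enum :: "nat list set \<Rightarrow> nat list list \<Rightarrow> bool" where
  "genealogical_enum T us \<longleftrightarrow>
     distinct us \<and> set us = T - {[]} \<and> sorted_wrt (\<lambda>u v. parent u \<noteq> v) us"

(* The finite-dimensional laws are given on measurable rectangles; the initial value of the
   integration variable off the root is irrelevant because it is overwritten. *)
definition branching_markov_process ::
  "'w measure \<Rightarrow> ('x::metric_space \<Rightarrow> 'x measure) \<Rightarrow> 'x measure \<Rightarrow> (nat list \<Rightarrow> 'w \<Rightarrow> 'x) \<Rightarrow> bool"
where
  "branching_markov_process M Q \<nu> X \<longleftrightarrow>
     prob_space M \<and> markov_kernel Q \<and> borel_prob \<nu> \<and>
     (\<forall>u\<in>UHN. X u \<in> M \<rightarrow>\<^sub>M borel) \<and>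
     (\<forall>T us B. finite_rooted_subtree T \<longrightarrow> genealogical_enum T us \<longrightarrow>
        (\<forall>u\<in>T. B u \<in> sets borel) \<longrightarrow>
        emeasure M {\<omega> \<in> space M. \<forall>u\<in>T. X u \<omega> \<in> B u} =
        (\<integral>\<^sup>+ x. tree_integral Q us (\<lambda>z. \<Prod>u\<in>T. indicator (B u) (z u)) ((\<lambda>_. undefined)([] := x)) \<partial>\<nu>))"

definition tree_average ::
  "nat list set \<Rightarrow> ('x \<Rightarrow> real) \<Rightarrow> (nat list \<Rightarrow> 'w \<Rightarrow> 'x) \<Rightarrow> 'w \<Rightarrow> real" where
  "tree_average A f X \<omega> = (\<Sum>u\<in>A. f (X u \<omega>)) / real (card A)"

section \<open>Convergence in L2\<close>

definition square_integrable :: "'w measure \<Rightarrow> ('w \<Rightarrow> real) \<Rightarrow> bool" where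
  "square_integrable M Y \<longleftrightarrow> Y \<in> borel_measurable M \<and> integrable M (\<lambda>\<omega>. (Y \<omega>)\<^sup>2)"

definition tendsto_L2 :: "'w measure \<Rightarrow> (nat \<Rightarrow> 'w \<Rightarrow> real) \<Rightarrow> ('w \<Rightarrow> real) \<Rightarrow> bool" where
  "tendsto_L2 M Y Z \<longleftrightarrow>
     (\<forall>n. square_integrable M (Y n)) \<and> square_integrable M Z \<and>
     (\<lambda>n. \<integral>\<omega>. (Y n \<omega> - Z \<omega>)\<^sup>2 \<partial>M) \<longlonglongrightarrow> 0"

end

theory Submission
  imports Defs
begin

text \<open>Let \<open>w\<close> be the last common ancestor of \<open>u = w @ r\<close> and \<open>v = w @ s\<close>, and write
  \<open>k\<close>, \<open>i\<close>, \<open>j\<close> for the lengths of \<open>w\<close>, \<open>r\<close>, \<open>s\<close>. Given the value at \<open>w\<close>, the values at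
  \<open>u\<close> and \<open>v\<close> are independent, so the expectation of \<open>(f (X u) - c) (f (X v) - c)\<close> is the
  \<open>\<nu>Q\<^sup>k\<close>-integral of \<open>(Q\<^sup>i f - c) (Q\<^sup>j f - c)\<close>. By Cauchy-Schwarz it is at most
  \<open>sqrt (\<Phi> k i * \<Phi> k j)\<close>, where \<open>\<Phi> k i\<close> is the \<open>\<nu>Q\<^sup>k\<close>-integral of
  \<open>(Q\<^sup>i f - c)\<^sup>2\<close>; by Jensen \<open>\<Phi>\<close> is bounded. Since \<open>d u v = i + j\<close>, sparsity makes \<open>i\<close> or
  \<open>j\<close> large for most pairs, and it remains to know that \<open>\<Phi> k i\<close> is small for large \<open>i\<close>,
  uniformly in the generations \<open>k\<close> that carry most of the mass: finitely many of them under (A),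
  all of them under (B).\<close>

section \<open>Iterated kernels\<close>

lemma borel_prob_iff_space_prob_algebra:
  "borel_prob \<mu> \<longleftrightarrow> \<mu> \<in> space (prob_algebra borel)"
  by (auto simp: borel_prob_def space_prob_algebra)

lemma markov_kernel_subprob:
  "markov_kernel Q \<Longrightarrow> Q \<in> borel \<rightarrow>\<^sub>M subprob_algebra borel"
  unfolding markov_kernel_def by (rule measurable_prob_algebraD)

lemma markov_kernel_borel_prob: "markov_kernel Q \<Longrightarrow> borel_prob (Q x)"
  unfolding markov_kernel_def borel_prob_iff_space_prob_algebra
  by (erule measurable_space) simp

lemma borel_prob_measurable:
  "borel_prob \<mu> \<Longrightarrow> measurable \<mu> N = measurable borel N"
  by (intro measurable_cong_sets) (auto simp: borel_prob_def)

lemma borel_prob_bind: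
  assumes "markov_kernel K" "borel_prob \<mu>"
  shows "borel_prob (\<mu> \<bind> K)"
  using assms prob_space_bind'[of \<mu> borel K borel] sets_bind'[of \<mu> borel K borel]
  unfolding markov_kernel_def borel_prob_iff_space_prob_algebra
  by (simp add: borel_prob_def flip: borel_prob_iff_space_prob_algebra)

lemma markov_kernel_bind:
  assumes "markov_kernel J" "markov_kernel K"
  shows "markov_kernel (\<lambda>x. J x \<bind> K)"
  using assms unfolding markov_kernel_def by (rule measurable_bind_prob_space)

lemma bind_markov_kernel_assoc:
  assumes "borel_prob \<mu>" "markov_kernel J" "markov_kernel K"
  shows "\<mu> \<bind> J \<bind> K = \<mu> \<bind> (\<lambda>x. J x \<bind> K)"
  by (rule bind_assoc[where N=borel and R=borel])
    (use assms in \<open>auto intro: markov_kernel_subprob simp: borel_prob_measurable\<close>)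

lemma measure_iter_0 [simp]: "measure_iter Q 0 \<mu> = \<mu>"
  by (simp add: measure_iter_def)

lemma measure_iter_Suc [simp]: "measure_iter Q (Suc n) \<mu> = measure_iter Q n \<mu> \<bind> Q"
  by (simp add: measure_iter_def)

lemma measure_iter_add: "measure_iter Q (m + n) \<mu> = measure_iter Q n (measure_iter Q m \<mu>)"
  by (induction n) auto

lemma borel_prob_measure_iter:
  "markov_kernel Q \<Longrightarrow> borel_prob \<mu> \<Longrightarrow> borel_prob (measure_iter Q n \<mu>)"
  by (induction n) (auto intro: borel_prob_bind)

lemma measure_iter_invariant: "invariant_measure Q \<mu> \<Longrightarrow> measure_iter Q n \<mu> = \<mu>"
  by (induction n) (auto simp: invariant_measure_def)

lemma kernel_pow_0 [simp]: "kernel_pow Q 0 x = return borel x"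
  by (simp add: kernel_pow_def)

lemma kernel_pow_Suc: "kernel_pow Q (Suc n) x = kernel_pow Q n x \<bind> Q"
  by (simp add: kernel_pow_def)

lemma markov_kernel_pow:
  assumes "markov_kernel Q"
  shows "markov_kernel (kernel_pow Q n)"
proof (induction n)
  case 0
  have "return borel \<in> borel \<rightarrow>\<^sub>M prob_algebra (borel :: 'a measure)"
    by (rule measurable_return_prob_space)
  also have "return borel = kernel_pow Q 0"
    by (simp add: fun_eq_iff)
  finally show ?case by (simp add: markov_kernel_def)
next
  case (Suc n)
  then show ?case using markov_kernel_bind[OF Suc assms] by (simp add: kernel_pow_Suc[abs_def])
qed

section \<open>Chapman-Kolmogorov identities\<close>

lemma measure_iter_eq_bind:
  assumes Q: "markov_kernel Q" and \<mu>: "borel_prob \<mu>"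
  shows "measure_iter Q n \<mu> = \<mu> \<bind> kernel_pow Q n"
proof (induction n)
  case 0
  show ?case using \<mu> by (simp add: bind_return'' borel_prob_def kernel_pow_0[abs_def])
next
  case (Suc n)
  have "measure_iter Q (Suc n) \<mu> = \<mu> \<bind> kernel_pow Q n \<bind> Q"
    by (simp add: Suc)
  also have "\<dots> = \<mu> \<bind> kernel_pow Q (Suc n)"
    unfolding bind_markov_kernel_assoc[OF \<mu> markov_kernel_pow[OF Q] Q]
    by (simp add: kernel_pow_Suc[abs_def])
  finally show ?case .
qed

text \<open>\<open>measure_iter\<close> adds new steps at the end. Here the first step is split off
  instead, the form that arises when kernels are integrated from a vertex downwards.\<close>

lemma kernel_pow_Suc':
  assumes "markov_kernel Q"
  shows "kernel_pow Q (Suc n) x = Q x \<bind> kernel_pow Q n"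
proof -
  have "kernel_pow Q (Suc n) x = measure_iter Q n (measure_iter Q 1 (return borel x))"
    by (simp only: kernel_pow_def flip: measure_iter_add) simp
  also have "measure_iter Q 1 (return borel x) = Q x"
    using bind_return[OF markov_kernel_subprob[OF assms], of x] by simp
  finally show ?thesis
    by (simp add: measure_iter_eq_bind[OF assms markov_kernel_borel_prob[OF assms]])
qed

lemma nn_integral_bind_kernel:
  assumes "markov_kernel K" "borel_prob \<mu>" "\<phi> \<in> borel_measurable borel"
  shows "(\<integral>\<^sup>+ y. \<phi> y \<partial>(\<mu> \<bind> K)) = (\<integral>\<^sup>+ x. \<integral>\<^sup>+ y. \<phi> y \<partial>K x \<partial>\<mu>)"
  by (rule nn_integral_bind[where B=borel])
    (use assms in \<open>auto intro: markov_kernel_subprob simp: borel_prob_measurable\<close>)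

text \<open>Associativity of composition, read on integrals. With values in \<open>ennreal\<close>
  the identity also covers the case that both sides are infinite.\<close>

lemma nn_integral_measure_iter_add:
  assumes "markov_kernel Q" "borel_prob \<nu>" "\<phi> \<in> borel_measurable borel"
  shows "(\<integral>\<^sup>+ y. \<phi> y \<partial>measure_iter Q (k + i) \<nu>)
    = (\<integral>\<^sup>+ x. \<integral>\<^sup>+ y. \<phi> y \<partial>kernel_pow Q i x \<partial>measure_iter Q k \<nu>)"
  using assms borel_prob_measure_iter[OF assms(1,2)]
  by (simp add: measure_iter_add measure_iter_eq_bind[of Q _ i] nn_integral_bind_kernel
      markov_kernel_pow)

lemma measurable_nn_integral_kernel:
  "markov_kernel K \<Longrightarrow> \<phi> \<in> borel_measurable borel
    \<Longrightarrow> (\<lambda>x. \<integral>\<^sup>+ y. \<phi> y \<partial>K x) \<in> borel_measurable borel"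
  by (rule measurable_compose[OF markov_kernel_subprob nn_integral_measurable_subprob_algebra])

lemma measurable_kernel_fun:
  "markov_kernel Q \<Longrightarrow> \<phi> \<in> borel_measurable borel \<Longrightarrow> kernel_fun Q n \<phi> \<in> borel_measurable borel"
  unfolding kernel_fun_def
  by (rule measurable_compose[OF markov_kernel_subprob[OF markov_kernel_pow]
        integral_measurable_subprob_algebra])

text \<open>Jensen's inequality for one kernel measure, read off from the non-negativity of a
  variance. Where the right-hand side is infinite there is nothing to show, so the default value 0
  of the Bochner integral does no harm.\<close>

lemma kernel_fun_sq_diff_le:
  assumes Q: "markov_kernel Q" and f[measurable]: "f \<in> borel_measurable borel"
  shows "ennreal ((kernel_fun Q i f x - c)\<^sup>2) \<le> (\<integral>\<^sup>+ y. ennreal ((f y - c)\<^sup>2) \<partial>kernel_pow Q i x)"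
proof (cases "(\<integral>\<^sup>+ y. ennreal ((f y - c)\<^sup>2) \<partial>kernel_pow Q i x) < \<infinity>")
  case True
  let ?K = "kernel_pow Q i x"
  have K: "borel_prob ?K" by (rule markov_kernel_borel_prob[OF markov_kernel_pow[OF Q]])
  interpret K: prob_space ?K using K by (simp add: borel_prob_def)
  have fK[measurable]: "f \<in> borel_measurable ?K" using f K by (simp add: borel_prob_measurable)
  have sq: "integrable ?K (\<lambda>y. (f y - c)\<^sup>2)"
    using True by (intro integrableI_nonneg) auto
  have i: "integrable ?K (\<lambda>y. f y - c)"
    by (rule K.square_integrable_imp_integrable[OF _ sq]) simp
  \<comment> \<open>Adding \<open>c\<close> back shows that \<open>f\<close> itself is integrable,
    so that \<open>kernel_fun Q i f x\<close> is a genuine mean.\<close>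
  have "integrable ?K (\<lambda>y. f y - c + c)"
    using i by (intro Bochner_Integration.integrable_add) auto
  then have "kernel_fun Q i f x - c = K.expectation (\<lambda>y. f y - c)"
    by (simp add: kernel_fun_def K.prob_space)
  then have "(kernel_fun Q i f x - c)\<^sup>2 \<le> K.expectation (\<lambda>y. (f y - c)\<^sup>2)"
    using K.variance_positive[of "\<lambda>y. f y - c"] K.variance_eq[OF i sq] by simp
  then have "ennreal ((kernel_fun Q i f x - c)\<^sup>2) \<le> ennreal (K.expectation (\<lambda>y. (f y - c)\<^sup>2))"
    by (rule ennreal_leI)
  also have "\<dots> = (\<integral>\<^sup>+ y. ennreal ((f y - c)\<^sup>2) \<partial>?K)"
    by (rule nn_integral_eq_integral[symmetric, OF sq]) simp
  finally show ?thesis .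
next
  case False
  then show ?thesis by (simp add: not_less top_unique)
qed

section \<open>Integrating along a line of descent\<close>

text \<open>Listed from top to bottom and without \<open>p\<close>: the value at \<open>p\<close> is
  where the chain of kernels starts, not an integration variable.\<close>

fun line_of_descent :: "nat list \<Rightarrow> nat list \<Rightarrow> nat list list" where
  "line_of_descent p [] = []"
| "line_of_descent p (a # r) = (p @ [a]) # line_of_descent (p @ [a]) r"

lemma set_line_of_descent:
  "set (line_of_descent p r) = (@) p ` ({t. prefix t r} - {[]})"
proof (induction r arbitrary: p)
  case (Cons a r)
  have "{t. prefix t (a # r)} - {[]} = (#) a ` {t. prefix t r}"
    by (auto simp: prefix_Cons)
  then show ?case by (auto simp: Cons image_image)
qed auto

lemma distinct_line_of_descent: "distinct (line_of_descent p r)"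
  by (induction r arbitrary: p) (auto simp: set_line_of_descent)

lemma sorted_line_of_descent:
  "sorted_wrt (\<lambda>u v. parent u \<noteq> v) (line_of_descent p r)"
proof (induction r arbitrary: p)
  case (Cons a r)
  have "parent (p @ [a]) \<noteq> v" if "v \<in> set (line_of_descent (p @ [a]) r)" for v
    using that by (auto simp: set_line_of_descent parent_def)
  then show ?case using Cons by simp
qed auto

text \<open>Lets the integrals over the last vertices be carried out first, so that a tree can be
  evaluated branch by branch.\<close>

lemma tree_integral_append:
  "tree_integral Q (us @ vs) F z = tree_integral Q us (tree_integral Q vs F) z"
  by (induction us arbitrary: z) auto

text \<open>Along a line each kernel starts from the value just integrated, so the kernels compose
  to a power of \<open>Q\<close>. The condition on \<open>F\<close> concerns only configurations
  that agree with \<open>z\<close> off the line: \<open>F\<close> may depend on other coordinates,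
  which are frozen at their values in \<open>z\<close> and absorbed into
  \<open>\<phi>\<close>.\<close>

lemma tree_integral_line_of_descent:
  assumes Q: "markov_kernel Q" and \<phi>: "\<phi> \<in> borel_measurable borel"
    and F: "\<And>z'. (\<And>v. v \<notin> set (line_of_descent p r) \<Longrightarrow> z' v = z v) \<Longrightarrow> F z' = \<phi> (z' (p @ r))"
  shows "tree_integral Q (line_of_descent p r) F z = (\<integral>\<^sup>+ y. \<phi> y \<partial>kernel_pow Q (length r) (z p))"
  using F
proof (induction r arbitrary: p z)
  case Nil
  then show ?case using \<phi> by (simp add: nn_integral_return)
next
  case (Cons a r)
  have "tree_integral Q (line_of_descent p (a # r)) F z
    = (\<integral>\<^sup>+ y. tree_integral Q (line_of_descent (p @ [a]) r) F (z(p @ [a] := y)) \<partial>Q (z p))"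
    by (simp add: parent_def)
  also have "\<dots> = (\<integral>\<^sup>+ y. \<integral>\<^sup>+ y'. \<phi> y' \<partial>kernel_pow Q (length r) y \<partial>Q (z p))"
  proof (rule nn_integral_cong)
    fix y
    have "tree_integral Q (line_of_descent (p @ [a]) r) F (z(p @ [a] := y))
      = (\<integral>\<^sup>+ y'. \<phi> y' \<partial>kernel_pow Q (length r) ((z(p @ [a] := y)) (p @ [a])))"
    proof (rule Cons.IH)
      fix z' assume *: "\<And>v. v \<notin> set (line_of_descent (p @ [a]) r) \<Longrightarrow> z' v = (z(p @ [a] := y)) v"
      have "F z' = \<phi> (z' (p @ a # r))"
        by (rule Cons.prems) (use * in auto)
      then show "F z' = \<phi> (z' ((p @ [a]) @ r))" by simp
    qed
    then show "tree_integral Q (line_of_descent (p @ [a]) r) F (z(p @ [a] := y))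
      = (\<integral>\<^sup>+ y'. \<phi> y' \<partial>kernel_pow Q (length r) y)" by simp
  qed
  also have "\<dots> = (\<integral>\<^sup>+ y. \<phi> y \<partial>kernel_pow Q (length (a # r)) (z p))"
    by (simp add: kernel_pow_Suc'[OF Q] nn_integral_bind_kernel[OF markov_kernel_pow[OF Q]
          markov_kernel_borel_prob[OF Q] \<phi>])
  finally show ?case .
qed

section \<open>The joint law at two vertices\<close>

text \<open>The last property says that the two branches separate immediately below the common
  ancestor; an empty branch covers the case that one vertex is an ancestor of the other or equal to
  it.\<close>

lemma longest_common_prefix_decomp:
  obtains r s where "u = longest_common_prefix u v @ r" "v = longest_common_prefix u v @ s"
    "r = [] \<or> s = [] \<or> hd r \<noteq> hd s"
proof -
  have "\<exists>r s. u = longest_common_prefix u v @ r \<and> v = longest_common_prefix u v @ s \<and>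
    (r = [] \<or> s = [] \<or> hd r \<noteq> hd s)"
    by (induction u v rule: longest_common_prefix.induct) auto
  then show ?thesis using that by blast
qed

lemma diverging_lines_disjoint:
  assumes "r = [] \<or> s = [] \<or> hd r \<noteq> hd s" "prefix t r" "prefix t s"
  shows "t = []"
  using assms by (cases t) (auto elim!: prefixE)

lemma finite_rooted_subtree_prefixes:
  assumes "u \<in> UHN" "v \<in> UHN"
  shows "finite_rooted_subtree ({t. prefix t u} \<union> {t. prefix t v})"
proof -
  have "finite {t. prefix t w}" for w :: "nat list"
    using finite_set[of "prefixes w"] by (simp add: in_set_prefixes[symmetric] del: in_set_prefixes)
  moreover have "t \<in> UHN" if "prefix t w" "w \<in> UHN" for t w
    using that by (auto simp: UHN_def elim!: prefixE)
  moreover have "prefix (parent t) w" if "prefix t w" for t w :: "nat list"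
    using that unfolding parent_def by (meson prefixeq_butlast prefix_order.trans)
  ultimately show ?thesis using assms unfolding finite_rooted_subtree_def by auto
qed

text \<open>The order is: the stem down to \<open>w\<close>, then one branch, then the other. No
  parent is listed too late, because stem vertices are shorter than branch vertices and a parent
  lying in the other branch would be a non-trivial common beginning of \<open>r\<close> and
  \<open>s\<close>.\<close>

lemma genealogical_enum_prefixes:
  assumes div: "r = [] \<or> s = [] \<or> hd r \<noteq> hd s"
  shows "genealogical_enum ({t. prefix t (w @ r)} \<union> {t. prefix t (w @ s)})
    (line_of_descent [] w @ line_of_descent w r @ line_of_descent w s)"
  unfolding genealogical_enum_def
proof (intro conjI)
  have "set (line_of_descent w r) \<inter> set (line_of_descent w s) = {}"
    using diverging_lines_disjoint[OF div] by (auto simp: set_line_of_descent)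
  moreover have "set (line_of_descent [] w) \<inter> set (line_of_descent w t) = {}" for t
    by (auto simp: set_line_of_descent)
  ultimately show "distinct (line_of_descent [] w @ line_of_descent w r @ line_of_descent w s)"
    by (auto simp: distinct_line_of_descent)
  show "set (line_of_descent [] w @ line_of_descent w r @ line_of_descent w s)
    = {t. prefix t (w @ r)} \<union> {t. prefix t (w @ s)} - {[]}"
    by (auto simp: set_line_of_descent prefix_append)
  have "parent x \<noteq> y" if "x \<in> set (line_of_descent [] w)" "y \<in> set (line_of_descent w t)" for x y t
  proof
    assume "parent x = y"
    with that have "length (parent x) = length y" "length x \<le> length w" "length w < length y"
      by (auto simp: set_line_of_descent prefix_length_le)
    then show False by (simp add: parent_def)
  qed
  moreover have "parent x \<noteq> y"
    if x: "x \<in> set (line_of_descent w r)" and y: "y \<in> set (line_of_descent w s)" for x y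
  proof
    assume eq: "parent x = y"
    obtain t where t: "x = w @ t" "prefix t r" "t \<noteq> []"
      using x by (auto simp: set_line_of_descent)
    obtain t' where t': "y = w @ t'" "prefix t' s" "t' \<noteq> []"
      using y by (auto simp: set_line_of_descent)
    \<comment> \<open>Since \<open>t\<close> is non-empty, deleting the last letter of
      \<open>w @ t\<close> only shortens \<open>t\<close>.\<close>
    have "butlast t = t'" using eq t t' by (simp add: parent_def butlast_append)
    then have "prefix t' r" using t(2) prefixeq_butlast prefix_order.trans by blast
    then show False using diverging_lines_disjoint[OF div _ t'(2)] t'(3) by blast
  qed
  ultimately show "sorted_wrt (\<lambda>u v. parent u \<noteq> v)
    (line_of_descent [] w @ line_of_descent w r @ line_of_descent w s)"
    by (auto simp: sorted_wrt_append sorted_line_of_descent)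
qed

section \<open>Rectangle probabilities for a pair of vertices\<close>

text \<open>This is the conditional independence of the two branches given the value at
  \<open>w\<close>. The integrals are evaluated from the inside out: the branch to
  \<open>w @ s\<close>, the branch to \<open>w @ r\<close>, and finally the stem.\<close>

lemma tree_integral_two_lines:
  assumes Q: "markov_kernel Q" and div: "r = [] \<or> s = [] \<or> hd r \<noteq> hd s"
    and B: "B \<in> sets borel" and C: "C \<in> sets borel"
    and F: "\<And>z. F z = indicator B (z (w @ r)) * indicator C (z (w @ s))"
  shows "tree_integral Q (line_of_descent [] w @ line_of_descent w r @ line_of_descent w s) F z
    = (\<integral>\<^sup>+ x. emeasure (kernel_pow Q (length r) x) B * emeasure (kernel_pow Q (length s) x) C
        \<partial>kernel_pow Q (length w) (z []))"
proof -
  have sets [simp]: "sets (kernel_pow Q n x) = sets borel" for n x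
    using markov_kernel_borel_prob[OF markov_kernel_pow[OF Q]] by (auto simp: borel_prob_def)
  have 1: "tree_integral Q (line_of_descent w s) F z'
    = indicator B (z' (w @ r)) * emeasure (kernel_pow Q (length s) (z' w)) C" for z'
  proof -
    \<comment> \<open>The vertex \<open>w @ r\<close> is not overwritten along the branch to
      \<open>w @ s\<close>, so its indicator is a constant factor there.\<close>
    have off: "w @ r \<notin> set (line_of_descent w s)"
      using div by (cases r) (auto simp: set_line_of_descent elim!: prefixE)
    have "tree_integral Q (line_of_descent w s) F z'
      = (\<integral>\<^sup>+ y. indicator B (z' (w @ r)) * indicator C y \<partial>kernel_pow Q (length s) (z' w))"
      by (rule tree_integral_line_of_descent[OF Q]) (use C F off in auto)
    also have "\<dots> = indicator B (z' (w @ r)) * emeasure (kernel_pow Q (length s) (z' w)) C"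
      by (rule nn_integral_cmult_indicator) (simp add: C)
    finally show ?thesis .
  qed
  have 2: "tree_integral Q (line_of_descent w r @ line_of_descent w s) F z'
    = emeasure (kernel_pow Q (length r) (z' w)) B * emeasure (kernel_pow Q (length s) (z' w)) C" for z'
  proof -
    let ?k = "emeasure (kernel_pow Q (length s) (z' w)) C"
    \<comment> \<open>The value at \<open>w\<close> survives the integration along the branch to
      \<open>w @ r\<close>, so \<open>?k\<close> is a constant factor.\<close>
    have off: "w \<notin> set (line_of_descent w r)"
      by (auto simp: set_line_of_descent)
    have "tree_integral Q (line_of_descent w r) (tree_integral Q (line_of_descent w s) F) z'
      = (\<integral>\<^sup>+ y. ?k * indicator B y \<partial>kernel_pow Q (length r) (z' w))"
      by (rule tree_integral_line_of_descent[OF Q])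
        (use B off in \<open>simp_all add: 1 mult.commute\<close>)
    also have "\<dots> = ?k * emeasure (kernel_pow Q (length r) (z' w)) B"
      by (rule nn_integral_cmult_indicator) (simp add: B)
    finally show ?thesis by (simp add: mult.commute tree_integral_append)
  qed
  have "tree_integral Q (line_of_descent [] w)
      (tree_integral Q (line_of_descent w r @ line_of_descent w s) F) z
    = (\<integral>\<^sup>+ x. emeasure (kernel_pow Q (length r) x) B * emeasure (kernel_pow Q (length s) x) C
        \<partial>kernel_pow Q (length w) (z []))"
    by (rule tree_integral_line_of_descent[OF Q])
      (use B C in \<open>auto simp: 2 intro!: borel_measurable_times_ennreal measurable_emeasure_kernel
        markov_kernel_subprob markov_kernel_pow[OF Q]\<close>)
  then show ?thesis by (simp only: tree_integral_append)
qed

lemma branching_markov_process_law: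
  assumes "branching_markov_process M Q \<nu> X" "finite_rooted_subtree T" "genealogical_enum T us"
    and "\<And>u. u \<in> T \<Longrightarrow> B u \<in> sets borel"
  shows "emeasure M {\<omega> \<in> space M. \<forall>u\<in>T. X u \<omega> \<in> B u} =
    (\<integral>\<^sup>+ x. tree_integral Q us (\<lambda>z. \<Prod>u\<in>T. indicator (B u) (z u)) ((\<lambda>_. undefined)([] := x)) \<partial>\<nu>)"
  using assms unfolding branching_markov_process_def by blast

text \<open>The finite-dimensional law is applied to the tree of all ancestors of the two vertices,
  with no restriction on the values at the other vertices.\<close>

lemma branching_markov_process_pair_law:
  assumes bmp: "branching_markov_process M Q \<nu> X"
    and div: "r = [] \<or> s = [] \<or> hd r \<noteq> hd s"
    and uv: "w @ r \<in> UHN" "w @ s \<in> UHN"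
    and B: "B \<in> sets borel" and C: "C \<in> sets borel"
  shows "emeasure M {\<omega> \<in> space M. X (w @ r) \<omega> \<in> B \<and> X (w @ s) \<omega> \<in> C}
    = (\<integral>\<^sup>+ x. emeasure (kernel_pow Q (length r) x) B * emeasure (kernel_pow Q (length s) x) C
        \<partial>measure_iter Q (length w) \<nu>)"
proof -
  let ?u = "w @ r" and ?v = "w @ s"
  let ?T = "{t. prefix t ?u} \<union> {t. prefix t ?v}"
  let ?us = "line_of_descent [] w @ line_of_descent w r @ line_of_descent w s"
  \<comment> \<open>The intersection takes care of the case \<open>?u = ?v\<close>, where a single
    vertex has to satisfy both constraints.\<close>
  let ?D = "\<lambda>t. (if t = ?u then B else UNIV) \<inter> (if t = ?v then C else UNIV)"
  let ?F = "\<lambda>z. \<Prod>t\<in>?T. indicator (?D t) (z t) :: ennreal"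
  have Q: "markov_kernel Q" and \<nu>: "borel_prob \<nu>"
    using bmp by (auto simp: branching_markov_process_def)
  have T: "finite_rooted_subtree ?T" by (rule finite_rooted_subtree_prefixes[OF uv])
  have F: "?F z = indicator B (z ?u) * indicator C (z ?v)" for z :: "nat list \<Rightarrow> 'b"
  proof -
    have fin: "finite ?T" using T by (simp add: finite_rooted_subtree_def)
    have "?F z = (\<Prod>t\<in>?T. (if t = ?u then indicator B (z t) else 1)
                       * (if t = ?v then indicator C (z t) else 1))"
      by (rule prod.cong) (auto simp: indicator_def)
    also have "\<dots> = (\<Prod>t\<in>?T. if t = ?u then indicator B (z t) else 1)
                  * (\<Prod>t\<in>?T. if t = ?v then indicator C (z t) else 1)"
      by (rule prod.distrib)
    also have "(\<Prod>t\<in>?T. if t = ?u then indicator B (z t) else 1) = (indicator B (z ?u) :: ennreal)"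
      using fin by (subst prod.delta) auto
    also have "(\<Prod>t\<in>?T. if t = ?v then indicator C (z t) else 1) = (indicator C (z ?v) :: ennreal)"
      using fin by (subst prod.delta) auto
    finally show ?thesis .
  qed
  have "emeasure M {\<omega> \<in> space M. X ?u \<omega> \<in> B \<and> X ?v \<omega> \<in> C}
    = emeasure M {\<omega> \<in> space M. \<forall>t\<in>?T. X t \<omega> \<in> ?D t}"
    by (rule arg_cong[where f="emeasure M"]) auto
  also have "\<dots> = (\<integral>\<^sup>+ x. tree_integral Q ?us ?F ((\<lambda>_. undefined)([] := x)) \<partial>\<nu>)"
    using B C
    by (intro branching_markov_process_law[OF bmp T genealogical_enum_prefixes[OF div]]) auto
  also have "\<dots> = (\<integral>\<^sup>+ x'. \<integral>\<^sup>+ x. emeasure (kernel_pow Q (length r) x) B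
      * emeasure (kernel_pow Q (length s) x) C \<partial>kernel_pow Q (length w) x' \<partial>\<nu>)"
    \<comment> \<open>The evaluated integral depends on the initial configuration only through its
      value at the root, so \<open>undefined\<close> disappears.\<close>
    by (subst tree_integral_two_lines[where F="?F", OF Q div B C F]) (simp only: fun_upd_same)
  also have "\<dots> = (\<integral>\<^sup>+ x. emeasure (kernel_pow Q (length r) x) B
      * emeasure (kernel_pow Q (length s) x) C \<partial>measure_iter Q (length w) \<nu>)"
    by (subst measure_iter_eq_bind[OF Q \<nu>], subst nn_integral_bind_kernel)
      (use B C Q \<nu> in \<open>auto intro!: borel_measurable_times_ennreal measurable_emeasure_kernel
        markov_kernel_subprob markov_kernel_pow\<close>)
  finally show ?thesis .
qed

section \<open>From rectangles to test functions\<close>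

text \<open>A monotone class argument in one variable, by induction over non-negative Borel
  functions. The weights \<open>g\<close> and \<open>k\<close> hold the contribution of the other
  vertex, so that two applications handle a product.\<close>

lemma nn_integral_kernel_eqI:
  fixes g :: "'w \<Rightarrow> ennreal"
  assumes Y: "Y \<in> M \<rightarrow>\<^sub>M borel" and g: "g \<in> borel_measurable M"
    and J: "markov_kernel J" and N: "borel_prob N" and k: "k \<in> borel_measurable borel"
    and ind: "\<And>B. B \<in> sets borel \<Longrightarrow>
      (\<integral>\<^sup>+ \<omega>. indicator B (Y \<omega>) * g \<omega> \<partial>M) = (\<integral>\<^sup>+ x. emeasure (J x) B * k x \<partial>N)"
    and \<phi>: "\<phi> \<in> borel_measurable borel"
  shows "(\<integral>\<^sup>+ \<omega>. \<phi> (Y \<omega>) * g \<omega> \<partial>M) = (\<integral>\<^sup>+ x. (\<integral>\<^sup>+ y. \<phi> y \<partial>J x) * k x \<partial>N)"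
proof -
  note [measurable] = Y g
  have kN[measurable]: "k \<in> borel_measurable N" using k N by (simp add: borel_prob_measurable)
  have JN[measurable]: "(\<lambda>x. \<integral>\<^sup>+ y. \<psi> y \<partial>J x) \<in> borel_measurable N"
    if "\<psi> \<in> borel_measurable borel" for \<psi>
    using measurable_nn_integral_kernel[OF J that] N by (simp add: borel_prob_measurable)
  have J_meas: "\<psi> \<in> borel_measurable (J x)" if "\<psi> \<in> borel_measurable borel" for \<psi> :: "_ \<Rightarrow> ennreal" and x
    using that markov_kernel_borel_prob[OF J] by (simp add: borel_prob_measurable)
  have setsJ: "sets (J x) = sets borel" for x
    using markov_kernel_borel_prob[OF J] by (simp add: borel_prob_def)
  show ?thesis
    using \<phi>
  proof (induction \<phi>)
    case (cong \<phi> \<psi>)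
    then show ?case by simp
  next
    case (set B)
    then show ?case using ind by (simp add: setsJ)
  next
    case (mult \<phi> a)
    note [measurable] = mult.hyps(2) and [simp] = J_meas[OF mult.hyps(2)]
    show ?case using mult by (simp add: nn_integral_cmult mult.assoc)
  next
    case (add \<phi> \<psi>)
    note [measurable] = add.hyps(1,3) and [simp] = J_meas[OF add.hyps(1)] J_meas[OF add.hyps(3)]
    show ?case using add by (simp add: nn_integral_add distrib_right)
  next
    case (seq U)
    note [measurable] = seq.hyps(1) and [simp] = J_meas[OF seq.hyps(1)]
    have U: "incseq U" by fact
    have "(\<integral>\<^sup>+ \<omega>. (SUP i. U i) (Y \<omega>) * g \<omega> \<partial>M) = (\<integral>\<^sup>+ \<omega>. (SUP i. U i (Y \<omega>) * g \<omega>) \<partial>M)"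
      by (simp add: SUP_apply SUP_mult_right_ennreal image_image)
    also have "\<dots> = (SUP i. \<integral>\<^sup>+ \<omega>. U i (Y \<omega>) * g \<omega> \<partial>M)"
      using U by (intro nn_integral_monotone_convergence_SUP)
        (auto simp: mono_def le_fun_def intro!: mult_right_mono)
    also have "\<dots> = (SUP i. \<integral>\<^sup>+ x. (\<integral>\<^sup>+ y. U i y \<partial>J x) * k x \<partial>N)"
      by (simp add: seq)
    also have "\<dots> = (\<integral>\<^sup>+ x. (SUP i. (\<integral>\<^sup>+ y. U i y \<partial>J x) * k x) \<partial>N)"
      using U by (intro nn_integral_monotone_convergence_SUP[symmetric])
        (auto simp: mono_def le_fun_def intro!: mult_right_mono nn_integral_mono)
    also have "\<dots> = (\<integral>\<^sup>+ x. (\<integral>\<^sup>+ y. (SUP i. U i) y \<partial>J x) * k x \<partial>N)"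
      using U by (simp add: SUP_apply nn_integral_monotone_convergence_SUP SUP_mult_right_ennreal
        image_image)
    finally show ?case .
  qed
qed

lemma branching_markov_process_nn_integral_pair:
  assumes bmp: "branching_markov_process M Q \<nu> X"
    and div: "r = [] \<or> s = [] \<or> hd r \<noteq> hd s"
    and uv: "w @ r \<in> UHN" "w @ s \<in> UHN"
    and \<phi>: "\<phi> \<in> borel_measurable borel" and \<psi>: "\<psi> \<in> borel_measurable borel"
  shows "(\<integral>\<^sup>+ \<omega>. \<phi> (X (w @ r) \<omega>) * \<psi> (X (w @ s) \<omega>) \<partial>M)
    = (\<integral>\<^sup>+ x. (\<integral>\<^sup>+ y. \<phi> y \<partial>kernel_pow Q (length r) x) * (\<integral>\<^sup>+ y. \<psi> y \<partial>kernel_pow Q (length s) x)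
        \<partial>measure_iter Q (length w) \<nu>)"
proof -
  let ?N = "measure_iter Q (length w) \<nu>"
  have Q: "markov_kernel Q" and \<nu>: "borel_prob \<nu>"
    and X[measurable]: "X (w @ r) \<in> M \<rightarrow>\<^sub>M borel" "X (w @ s) \<in> M \<rightarrow>\<^sub>M borel"
    using bmp uv by (auto simp: branching_markov_process_def)
  note N = borel_prob_measure_iter[OF Q \<nu>] and K = markov_kernel_pow[OF Q]
  note [measurable] = \<psi>
  \<comment> \<open>First extension: an arbitrary function at \<open>w @ s\<close>, with an
    indicator at \<open>w @ r\<close> as weight. The second extension then exchanges the roles of
    the vertices.\<close>
  have 1: "(\<integral>\<^sup>+ \<omega>. \<psi> (X (w @ s) \<omega>) * indicator B (X (w @ r) \<omega>) \<partial>M)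
    = (\<integral>\<^sup>+ x. (\<integral>\<^sup>+ y. \<psi> y \<partial>kernel_pow Q (length s) x) * emeasure (kernel_pow Q (length r) x) B \<partial>?N)"
    if B[measurable]: "B \<in> sets borel" for B
  proof (rule nn_integral_kernel_eqI[OF X(2) _ K N _ _ \<psi>])
    fix C :: "'b set" assume C: "C \<in> sets borel"
    have "(\<integral>\<^sup>+ \<omega>. indicator C (X (w @ s) \<omega>) * indicator B (X (w @ r) \<omega>) \<partial>M)
      = (\<integral>\<^sup>+ \<omega>. indicator {\<omega> \<in> space M. X (w @ r) \<omega> \<in> B \<and> X (w @ s) \<omega> \<in> C} \<omega> \<partial>M)"
      by (rule nn_integral_cong) (auto simp: indicator_def)
    also have "\<dots> = emeasure M {\<omega> \<in> space M. X (w @ r) \<omega> \<in> B \<and> X (w @ s) \<omega> \<in> C}"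
      using B C by (intro nn_integral_indicator) simp
    finally show "(\<integral>\<^sup>+ \<omega>. indicator C (X (w @ s) \<omega>) * indicator B (X (w @ r) \<omega>) \<partial>M)
      = (\<integral>\<^sup>+ x. emeasure (kernel_pow Q (length s) x) C * emeasure (kernel_pow Q (length r) x) B \<partial>?N)"
      by (simp add: branching_markov_process_pair_law[OF bmp div uv B C] mult.commute)
  qed (auto intro: measurable_emeasure_kernel[OF markov_kernel_subprob[OF K]])
  show ?thesis
    by (rule nn_integral_kernel_eqI[OF X(1) _ K N _ _ \<phi>])
      (auto simp: 1[symmetric] mult.commute intro: measurable_nn_integral_kernel[OF K \<psi>])
qed

text \<open>The pair formula with both branches empty and second test function 1; the kernels below
  \<open>u\<close> are then Dirac masses.\<close>

lemma branching_markov_process_nn_integral: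
  assumes bmp: "branching_markov_process M Q \<nu> X" and u: "u \<in> UHN"
    and \<phi>: "\<phi> \<in> borel_measurable borel"
  shows "(\<integral>\<^sup>+ \<omega>. \<phi> (X u \<omega>) \<partial>M) = (\<integral>\<^sup>+ x. \<phi> x \<partial>measure_iter Q (length u) \<nu>)"
  using branching_markov_process_nn_integral_pair[OF bmp, of "[]" "[]" u \<phi> "\<lambda>_. 1"] u \<phi>
  by (simp add: nn_integral_return)

section \<open>Integrability from second moments\<close>

lemma integrable_of_sq:
  fixes f :: "'a :: metric_space \<Rightarrow> real"
  assumes K: "borel_prob K" and f: "f \<in> borel_measurable borel"
    and fin: "(\<integral>\<^sup>+ y. ennreal ((f y)\<^sup>2) \<partial>K) < \<infinity>"
  shows "integrable K f"
proof -
  interpret prob_space K using K by (simp add: borel_prob_def)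
  have fK[measurable]: "f \<in> borel_measurable K" using f K by (simp add: borel_prob_measurable)
  have "integrable K (\<lambda>y. (f y)\<^sup>2)"
    using fin by (intro integrableI_nonneg) auto
  then show ?thesis by (rule square_integrable_imp_integrable[OF fK])
qed

text \<open>The second moment in generation \<open>k + i\<close> is the mean of the second moments
  of the kernels, which are therefore finite almost everywhere. Hence \<open>kernel_fun\<close>
  takes its default value for non-integrable functions only on a null set.\<close>

lemma AE_integrable_kernel_pow:
  assumes Q: "markov_kernel Q" and \<nu>: "borel_prob \<nu>" and f: "f \<in> borel_measurable borel"
    and fin: "(\<integral>\<^sup>+ y. ennreal ((f y)\<^sup>2) \<partial>measure_iter Q (k + i) \<nu>) < \<infinity>"
  shows "AE x in measure_iter Q k \<nu>. integrable (kernel_pow Q i x) f"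
proof -
  let ?g = "\<lambda>x. \<integral>\<^sup>+ y. ennreal ((f y)\<^sup>2) \<partial>kernel_pow Q i x"
  note K = markov_kernel_pow[OF Q, of i]
  have f2: "(\<lambda>y. ennreal ((f y)\<^sup>2)) \<in> borel_measurable borel" using f by simp
  have "?g \<in> borel_measurable (measure_iter Q k \<nu>)"
    using measurable_nn_integral_kernel[OF K f2] borel_prob_measure_iter[OF Q \<nu>]
    by (simp add: borel_prob_measurable)
  moreover have "(\<integral>\<^sup>+ x. ?g x \<partial>measure_iter Q k \<nu>) \<noteq> \<infinity>"
    using fin by (simp add: nn_integral_measure_iter_add[OF Q \<nu> f2])
  ultimately have "AE x in measure_iter Q k \<nu>. ?g x \<noteq> \<infinity>"
    by (rule nn_integral_PInf_AE)
  then show ?thesis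
    by eventually_elim (auto intro: integrable_of_sq[OF markov_kernel_borel_prob[OF K] f]
        simp: less_top)
qed

lemma measurable_kernel_fun_iter:
  assumes "markov_kernel Q" "borel_prob \<nu>" "f \<in> borel_measurable borel"
  shows "kernel_fun Q i f \<in> borel_measurable (measure_iter Q k \<nu>)"
  using measurable_kernel_fun[OF assms(1,3)] borel_prob_measure_iter[OF assms(1,2)]
  by (simp add: borel_prob_measurable)

section \<open>The product formula for real-valued functions and its Cauchy-Schwarz bound\<close>

text \<open>The common number \<open>I\<close> records integrability on both sides together with
  equality of the integrals, a form that can be added and subtracted later.\<close>

lemma pair_expectation_nonneg:
  assumes bmp: "branching_markov_process M Q \<nu> X"
    and div: "r = [] \<or> s = [] \<or> hd r \<noteq> hd s"
    and uv: "w @ r \<in> UHN" "w @ s \<in> UHN"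
    and \<phi>: "\<phi> \<in> borel_measurable borel" "\<And>x. 0 \<le> \<phi> x"
    and \<psi>: "\<psi> \<in> borel_measurable borel" "\<And>x. 0 \<le> \<psi> x"
    and \<phi>2: "(\<integral>\<^sup>+ y. ennreal ((\<phi> y)\<^sup>2) \<partial>measure_iter Q (length w + length r) \<nu>) < \<infinity>"
    and \<psi>2: "(\<integral>\<^sup>+ y. ennreal ((\<psi> y)\<^sup>2) \<partial>measure_iter Q (length w + length s) \<nu>) < \<infinity>"
  shows "\<exists>I. has_bochner_integral M (\<lambda>\<omega>. \<phi> (X (w @ r) \<omega>) * \<psi> (X (w @ s) \<omega>)) I \<and>
    has_bochner_integral (measure_iter Q (length w) \<nu>)
      (\<lambda>x. kernel_fun Q (length r) \<phi> x * kernel_fun Q (length s) \<psi> x) I"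
proof -
  let ?N = "measure_iter Q (length w) \<nu>"
  let ?u = "w @ r" and ?v = "w @ s"
  have Q: "markov_kernel Q" and \<nu>: "borel_prob \<nu>"
    and X[measurable]: "X ?u \<in> M \<rightarrow>\<^sub>M borel" "X ?v \<in> M \<rightarrow>\<^sub>M borel"
    using bmp uv by (auto simp: branching_markov_process_def)
  note [measurable] = \<phi>(1) \<psi>(1)
    measurable_kernel_fun_iter[OF Q \<nu> \<phi>(1)] measurable_kernel_fun_iter[OF Q \<nu> \<psi>(1)]
  define I where "I = (\<integral>\<^sup>+ \<omega>. ennreal (\<phi> (X ?u \<omega>) * \<psi> (X ?v \<omega>)) \<partial>M)"
  have "I = (\<integral>\<^sup>+ \<omega>. ennreal (\<phi> (X ?u \<omega>)) * ennreal (\<psi> (X ?v \<omega>)) \<partial>M)"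
    using \<phi>(2) \<psi>(2) by (simp add: I_def ennreal_mult)
  also have "\<dots> = (\<integral>\<^sup>+ x. (\<integral>\<^sup>+ y. \<phi> y \<partial>kernel_pow Q (length r) x)
      * (\<integral>\<^sup>+ y. \<psi> y \<partial>kernel_pow Q (length s) x) \<partial>?N)"
    by (rule branching_markov_process_nn_integral_pair[OF bmp div uv]) simp_all
  also have "\<dots> = (\<integral>\<^sup>+ x. ennreal (kernel_fun Q (length r) \<phi> x * kernel_fun Q (length s) \<psi> x) \<partial>?N)"
  proof (rule nn_integral_cong_AE)
    show "AE x in ?N. (\<integral>\<^sup>+ y. \<phi> y \<partial>kernel_pow Q (length r) x)
        * (\<integral>\<^sup>+ y. \<psi> y \<partial>kernel_pow Q (length s) x)
      = ennreal (kernel_fun Q (length r) \<phi> x * kernel_fun Q (length s) \<psi> x)"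
      using AE_integrable_kernel_pow[OF Q \<nu> \<phi>(1) \<phi>2] AE_integrable_kernel_pow[OF Q \<nu> \<psi>(1) \<psi>2]
    proof eventually_elim
      case (elim x)
      then show ?case
        using \<phi>(2) \<psi>(2)
        by (simp add: kernel_fun_def nn_integral_eq_integral ennreal_mult integral_nonneg)
    qed
  qed
  finally have I_N: "I = (\<integral>\<^sup>+ x. ennreal (kernel_fun Q (length r) \<phi> x * kernel_fun Q (length s) \<psi> x) \<partial>?N)" .
  \<comment> \<open>A product of non-negative reals is at most the sum of their squares, so the two
    second moments make \<open>I\<close> finite.\<close>
  have "I \<le> (\<integral>\<^sup>+ \<omega>. ennreal ((\<phi> (X ?u \<omega>))\<^sup>2) + ennreal ((\<psi> (X ?v \<omega>))\<^sup>2) \<partial>M)"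
    unfolding I_def
  proof (rule nn_integral_mono)
    fix \<omega>
    have "\<phi> (X ?u \<omega>) * \<psi> (X ?v \<omega>) \<le> (\<phi> (X ?u \<omega>))\<^sup>2 + (\<psi> (X ?v \<omega>))\<^sup>2"
      using sum_squares_bound[of "\<phi> (X ?u \<omega>)" "\<psi> (X ?v \<omega>)"]
        mult_nonneg_nonneg[OF \<phi>(2)[of "X ?u \<omega>"] \<psi>(2)[of "X ?v \<omega>"]]
      by linarith
    then show "ennreal (\<phi> (X ?u \<omega>) * \<psi> (X ?v \<omega>)) \<le> ennreal ((\<phi> (X ?u \<omega>))\<^sup>2) + ennreal ((\<psi> (X ?v \<omega>))\<^sup>2)"
      by (simp add: ennreal_leI flip: ennreal_plus)
  qed
  also have "\<dots> = (\<integral>\<^sup>+ \<omega>. ennreal ((\<phi> (X ?u \<omega>))\<^sup>2) \<partial>M) + (\<integral>\<^sup>+ \<omega>. ennreal ((\<psi> (X ?v \<omega>))\<^sup>2) \<partial>M)"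
    by (rule nn_integral_add) simp_all
  also have "\<dots> < \<infinity>"
    using branching_markov_process_nn_integral[OF bmp uv(1), of "\<lambda>y. ennreal ((\<phi> y)\<^sup>2)"]
      branching_markov_process_nn_integral[OF bmp uv(2), of "\<lambda>y. ennreal ((\<psi> y)\<^sup>2)"] \<phi>2 \<psi>2
    by simp
  finally obtain J where J: "0 \<le> J" "I = ennreal J"
    by (cases I) auto
  have nonneg: "0 \<le> kernel_fun Q (length r) \<phi> x * kernel_fun Q (length s) \<psi> x" for x
    using \<phi>(2) \<psi>(2) by (simp add: kernel_fun_def integral_nonneg)
  have "has_bochner_integral M (\<lambda>\<omega>. \<phi> (X ?u \<omega>) * \<psi> (X ?v \<omega>)) J"
    using \<phi>(2) \<psi>(2) J I_def by (intro has_bochner_integral_nn_integral) auto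
  moreover have "has_bochner_integral ?N
      (\<lambda>x. kernel_fun Q (length r) \<phi> x * kernel_fun Q (length s) \<psi> x) J"
    using nonneg J I_N by (intro has_bochner_integral_nn_integral) auto
  ultimately show ?thesis by blast
qed

text \<open>Both sides are bilinear, so the non-negative case is applied to the four products of the
  positive part \<open>p\<close> and the negative part \<open>m\<close> of
  \<open>f - c\<close>.\<close>

lemma pair_expectation:
  assumes bmp: "branching_markov_process M Q \<nu> X"
    and div: "r = [] \<or> s = [] \<or> hd r \<noteq> hd s"
    and uv: "w @ r \<in> UHN" "w @ s \<in> UHN"
    and f: "f \<in> borel_measurable borel"
    and fin: "\<And>n. (\<integral>\<^sup>+ x. ennreal ((f x - c)\<^sup>2) \<partial>measure_iter Q n \<nu>) < \<infinity>"
  shows "\<exists>I. has_bochner_integral M (\<lambda>\<omega>. (f (X (w @ r) \<omega>) - c) * (f (X (w @ s) \<omega>) - c)) I \<and>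
    has_bochner_integral (measure_iter Q (length w) \<nu>)
      (\<lambda>x. (kernel_fun Q (length r) f x - c) * (kernel_fun Q (length s) f x - c)) I"
proof -
  let ?N = "measure_iter Q (length w) \<nu>"
  define p where "p x = max 0 (f x - c)" for x
  define m where "m x = max 0 (c - f x)" for x
  have Q: "markov_kernel Q" and \<nu>: "borel_prob \<nu>"
    using bmp by (auto simp: branching_markov_process_def)
  have f_eq: "f x - c = p x - m x" for x by (auto simp: p_def m_def)
  have p[measurable]: "p \<in> borel_measurable borel" and p0: "\<And>x. 0 \<le> p x"
    using f by (auto simp: p_def[abs_def])
  have m[measurable]: "m \<in> borel_measurable borel" and m0: "\<And>x. 0 \<le> m x"
    using f by (auto simp: m_def[abs_def])
  have pfin: "(\<integral>\<^sup>+ x. ennreal ((p x)\<^sup>2) \<partial>measure_iter Q n \<nu>) < \<infinity>" for n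
    by (rule le_less_trans[OF nn_integral_mono fin[of n]])
      (auto intro!: ennreal_leI simp: p_def max_def)
  have mfin: "(\<integral>\<^sup>+ x. ennreal ((m x)\<^sup>2) \<partial>measure_iter Q n \<nu>) < \<infinity>" for n
    by (rule le_less_trans[OF nn_integral_mono fin[of n]])
      (auto intro!: ennreal_leI simp: m_def max_def power2_commute)
  note E = pair_expectation_nonneg[OF bmp div uv]
  obtain Ipp where pp: "has_bochner_integral M (\<lambda>\<omega>. p (X (w @ r) \<omega>) * p (X (w @ s) \<omega>)) Ipp"
    "has_bochner_integral ?N (\<lambda>x. kernel_fun Q (length r) p x * kernel_fun Q (length s) p x) Ipp"
    using E[OF p p0 p p0 pfin pfin] by blast
  obtain Ipm where pm: "has_bochner_integral M (\<lambda>\<omega>. p (X (w @ r) \<omega>) * m (X (w @ s) \<omega>)) Ipm"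
    "has_bochner_integral ?N (\<lambda>x. kernel_fun Q (length r) p x * kernel_fun Q (length s) m x) Ipm"
    using E[OF p p0 m m0 pfin mfin] by blast
  obtain Imp where mp: "has_bochner_integral M (\<lambda>\<omega>. m (X (w @ r) \<omega>) * p (X (w @ s) \<omega>)) Imp"
    "has_bochner_integral ?N (\<lambda>x. kernel_fun Q (length r) m x * kernel_fun Q (length s) p x) Imp"
    using E[OF m m0 p p0 mfin pfin] by blast
  obtain Imm where mm: "has_bochner_integral M (\<lambda>\<omega>. m (X (w @ r) \<omega>) * m (X (w @ s) \<omega>)) Imm"
    "has_bochner_integral ?N (\<lambda>x. kernel_fun Q (length r) m x * kernel_fun Q (length s) m x) Imm"
    using E[OF m m0 m m0 mfin mfin] by blast
  \<comment> \<open>The signs come from expanding the product of two copies of \<open>p - m\<close>;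
    the same number serves both sides.\<close>
  let ?I = "Ipp - Ipm - (Imp - Imm)"
  have "has_bochner_integral M (\<lambda>\<omega>. (f (X (w @ r) \<omega>) - c) * (f (X (w @ s) \<omega>) - c)) ?I"
    using has_bochner_integral_diff[OF has_bochner_integral_diff[OF pp(1) pm(1)]
        has_bochner_integral_diff[OF mp(1) mm(1)]]
    by (simp add: f_eq algebra_simps)
  moreover have "has_bochner_integral ?N
      (\<lambda>x. (kernel_fun Q (length r) f x - c) * (kernel_fun Q (length s) f x - c)) ?I"
  proof -
    \<comment> \<open>This splitting needs \<open>p\<close> and \<open>m\<close> to be integrable
      under the kernel, hence holds only almost everywhere.\<close>
    have AE_diff: "AE x in ?N. kernel_fun Q i f x - c = kernel_fun Q i p x - kernel_fun Q i m x" for i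
      using AE_integrable_kernel_pow[OF Q \<nu> p pfin, of i "length w"]
        AE_integrable_kernel_pow[OF Q \<nu> m mfin, of i "length w"]
    proof eventually_elim
      case (elim x)
      interpret K: prob_space "kernel_pow Q i x"
        using markov_kernel_borel_prob[OF markov_kernel_pow[OF Q]] by (simp add: borel_prob_def)
      have "integral\<^sup>L (kernel_pow Q i x) (\<lambda>y. (p y - m y) + c)
        = kernel_fun Q i p x - kernel_fun Q i m x + c"
        using elim by (simp add: kernel_fun_def K.prob_space)
      also have "(\<lambda>y. (p y - m y) + c) = f" by (simp flip: f_eq)
      finally show ?case by (simp add: kernel_fun_def)
    qed
    note [measurable] = measurable_kernel_fun_iter[OF Q \<nu> f] measurable_kernel_fun_iter[OF Q \<nu> p]
      measurable_kernel_fun_iter[OF Q \<nu> m]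
    have "has_bochner_integral ?N
        (\<lambda>x. (kernel_fun Q (length r) p x - kernel_fun Q (length r) m x)
           * (kernel_fun Q (length s) p x - kernel_fun Q (length s) m x)) ?I"
      using has_bochner_integral_diff[OF has_bochner_integral_diff[OF pp(2) pm(2)]
          has_bochner_integral_diff[OF mp(2) mm(2)]]
      by (simp add: algebra_simps)
    moreover have "AE x in ?N. (kernel_fun Q (length r) f x - c) * (kernel_fun Q (length s) f x - c)
      = (kernel_fun Q (length r) p x - kernel_fun Q (length r) m x)
           * (kernel_fun Q (length s) p x - kernel_fun Q (length s) m x)"
      using AE_diff[of "length r"] AE_diff[of "length s"] by eventually_elim simp
    ultimately show ?thesis by (subst has_bochner_integral_cong_AE) auto
  qed
  ultimately show ?thesis by blast
qed

text \<open>Cauchy-Schwarz in the generation of the common ancestor, kept in squared form so that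
  the right-hand side stays in \<open>ennreal\<close>.\<close>

lemma pair_expectation_sq_le:
  assumes bmp: "branching_markov_process M Q \<nu> X"
    and div: "r = [] \<or> s = [] \<or> hd r \<noteq> hd s"
    and uv: "w @ r \<in> UHN" "w @ s \<in> UHN"
    and f: "f \<in> borel_measurable borel"
    and fin: "\<And>n. (\<integral>\<^sup>+ x. ennreal ((f x - c)\<^sup>2) \<partial>measure_iter Q n \<nu>) < \<infinity>"
  shows "integrable M (\<lambda>\<omega>. (f (X (w @ r) \<omega>) - c) * (f (X (w @ s) \<omega>) - c))"
    and "ennreal ((\<integral>\<omega>. (f (X (w @ r) \<omega>) - c) * (f (X (w @ s) \<omega>) - c) \<partial>M)\<^sup>2)
      \<le> (\<integral>\<^sup>+ x. ennreal ((kernel_fun Q (length r) f x - c)\<^sup>2) \<partial>measure_iter Q (length w) \<nu>)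
       * (\<integral>\<^sup>+ x. ennreal ((kernel_fun Q (length s) f x - c)\<^sup>2) \<partial>measure_iter Q (length w) \<nu>)"
proof -
  let ?N = "measure_iter Q (length w) \<nu>"
  let ?P = "\<lambda>t x. kernel_fun Q (length t) f x - c"
  have Q: "markov_kernel Q" and \<nu>: "borel_prob \<nu>"
    using bmp by (auto simp: branching_markov_process_def)
  note [measurable] = measurable_kernel_fun_iter[OF Q \<nu> f]
  obtain I where I: "has_bochner_integral M (\<lambda>\<omega>. (f (X (w @ r) \<omega>) - c) * (f (X (w @ s) \<omega>) - c)) I"
    "has_bochner_integral ?N (\<lambda>x. ?P r x * ?P s x) I"
    using pair_expectation[OF assms] by blast
  from I(1) show "integrable M (\<lambda>\<omega>. (f (X (w @ r) \<omega>) - c) * (f (X (w @ s) \<omega>) - c))"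
    by (rule integrable.intros)
  have "ennreal \<bar>I\<bar> = ennreal (norm (\<integral>x. ?P r x * ?P s x \<partial>?N))"
    using I(2) by (simp add: has_bochner_integral_integral_eq)
  also have "\<dots> \<le> (\<integral>\<^sup>+ x. ennreal (norm (?P r x * ?P s x)) \<partial>?N)"
    using I(2) by (intro integral_norm_bound_ennreal) (rule integrable.intros)
  also have "\<dots> = (\<integral>\<^sup>+ x. ennreal \<bar>?P r x\<bar> * ennreal \<bar>?P s x\<bar> \<partial>?N)"
    by (simp add: abs_mult ennreal_mult)
  finally have "(ennreal \<bar>I\<bar>)\<^sup>2 \<le> (\<integral>\<^sup>+ x. ennreal \<bar>?P r x\<bar> * ennreal \<bar>?P s x\<bar> \<partial>?N)\<^sup>2"
    by (rule power_mono) simp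
  also have "\<dots> \<le> (\<integral>\<^sup>+ x. (ennreal \<bar>?P r x\<bar>)\<^sup>2 \<partial>?N) * (\<integral>\<^sup>+ x. (ennreal \<bar>?P s x\<bar>)\<^sup>2 \<partial>?N)"
    by (rule Cauchy_Schwarz_nn_integral) simp_all
  finally show "ennreal ((\<integral>\<omega>. (f (X (w @ r) \<omega>) - c) * (f (X (w @ s) \<omega>) - c) \<partial>M)\<^sup>2)
      \<le> (\<integral>\<^sup>+ x. ennreal ((?P r x)\<^sup>2) \<partial>?N) * (\<integral>\<^sup>+ x. ennreal ((?P s x)\<^sup>2) \<partial>?N)"
    using I(1) by (simp add: has_bochner_integral_integral_eq ennreal_power)
qed

section \<open>Second moment of tree averages\<close>

text \<open>Turns probabilities of events on pairs into normalized counts over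
  \<open>A \<times> A\<close>.\<close>

lemma uniform_pair_eq_pmf_of_set:
  assumes "finite A" "A \<noteq> {}"
  shows "uniform_pair A = pmf_of_set (A \<times> A)"
proof (rule pmf_eqI)
  fix p :: "nat list \<times> nat list"
  show "pmf (uniform_pair A) p = pmf (pmf_of_set (A \<times> A)) p"
    using assms by (cases p) (simp add: uniform_pair_def pmf_pair pmf_of_set indicator_def)
qed

text \<open>Jensen's inequality integrated over generation \<open>k\<close>: a bound on the second
  moments of \<open>f - c\<close> in all generations also bounds those of its images under the
  kernels.\<close>

lemma nn_integral_kernel_fun_sq_diff_le:
  assumes Q: "markov_kernel Q" and \<nu>: "borel_prob \<nu>" and f: "f \<in> borel_measurable borel"
  shows "(\<integral>\<^sup>+ x. ennreal ((kernel_fun Q i f x - c)\<^sup>2) \<partial>measure_iter Q k \<nu>)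
    \<le> (\<integral>\<^sup>+ x. ennreal ((f x - c)\<^sup>2) \<partial>measure_iter Q (k + i) \<nu>)"
proof -
  have "(\<integral>\<^sup>+ x. ennreal ((f x - c)\<^sup>2) \<partial>measure_iter Q (k + i) \<nu>)
    = (\<integral>\<^sup>+ x. \<integral>\<^sup>+ y. ennreal ((f y - c)\<^sup>2) \<partial>kernel_pow Q i x \<partial>measure_iter Q k \<nu>)"
    by (rule nn_integral_measure_iter_add[OF Q \<nu>]) (use f in simp)
  then show ?thesis
    by (simp add: nn_integral_mono kernel_fun_sq_diff_le[OF Q f])
qed

lemma pair_expectation_common_ancestor:
  assumes bmp: "branching_markov_process M Q \<nu> X"
    and uv: "u \<in> UHN" "v \<in> UHN"
    and f: "f \<in> borel_measurable borel"
    and fin: "\<And>n. (\<integral>\<^sup>+ x. ennreal ((f x - c)\<^sup>2) \<partial>measure_iter Q n \<nu>) < \<infinity>"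
  obtains i j where "tree_dist u v = i + j"
    "integrable M (\<lambda>\<omega>. (f (X u \<omega>) - c) * (f (X v \<omega>) - c))"
    "ennreal ((\<integral>\<omega>. (f (X u \<omega>) - c) * (f (X v \<omega>) - c) \<partial>M)\<^sup>2)
      \<le> (\<integral>\<^sup>+ x. ennreal ((kernel_fun Q i f x - c)\<^sup>2)
          \<partial>measure_iter Q (tree_height (common_ancestor u v)) \<nu>)
       * (\<integral>\<^sup>+ x. ennreal ((kernel_fun Q j f x - c)\<^sup>2)
          \<partial>measure_iter Q (tree_height (common_ancestor u v)) \<nu>)"
proof -
  define w where "w = longest_common_prefix u v"
  obtain r s where rs: "u = w @ r" "v = w @ s" and div: "r = [] \<or> s = [] \<or> hd r \<noteq> hd s"
    unfolding w_def by (rule longest_common_prefix_decomp)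
  have w: "common_ancestor u v = w" by (simp add: common_ancestor_def w_def)
  have "tree_dist u v = length r + length s"
    unfolding tree_dist_def w by (simp add: tree_height_def rs)
  then show ?thesis
    using that pair_expectation_sq_le[OF bmp div uv[unfolded rs] f fin] by (simp add: rs w[unfolded rs] tree_height_def)
qed

text \<open>\<open>P\<close> marks the good generations and \<open>m\<close> the branch length from
  which the decay is effective. If the distance exceeds \<open>2 * m\<close>, one of the two
  branches is longer than \<open>m\<close>; its factor is at most \<open>\<delta>\<close> and the
  other at most \<open>C\<close>. Every other pair falls under one of the two indicators and costs
  at most \<open>C\<close>.\<close>

lemma pair_expectation_le:
  assumes bmp: "branching_markov_process M Q \<nu> X"
    and uv: "u \<in> UHN" "v \<in> UHN"
    and f: "f \<in> borel_measurable borel"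
    and C: "0 \<le> C" "\<And>n. (\<integral>\<^sup>+ x. ennreal ((f x - c)\<^sup>2) \<partial>measure_iter Q n \<nu>) \<le> ennreal C"
    and \<delta>: "0 \<le> \<delta>"
      "\<And>k i. P k \<Longrightarrow> m < i \<Longrightarrow> (\<integral>\<^sup>+ x. ennreal ((kernel_fun Q i f x - c)\<^sup>2) \<partial>measure_iter Q k \<nu>) \<le> ennreal \<delta>"
  shows "integrable M (\<lambda>\<omega>. (f (X u \<omega>) - c) * (f (X v \<omega>) - c))"
    and "(\<integral>\<omega>. (f (X u \<omega>) - c) * (f (X v \<omega>) - c) \<partial>M)
      \<le> sqrt (\<delta> * C) + C * indicator {(u, v). tree_dist u v \<le> 2 * m} (u, v)
        + C * indicator {(u, v). \<not> P (tree_height (common_ancestor u v))} (u, v)"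
proof -
  let ?k = "tree_height (common_ancestor u v)"
  let ?E = "\<integral>\<omega>. (f (X u \<omega>) - c) * (f (X v \<omega>) - c) \<partial>M"
  let ?\<Phi> = "\<lambda>i. \<integral>\<^sup>+ x. ennreal ((kernel_fun Q i f x - c)\<^sup>2) \<partial>measure_iter Q ?k \<nu>"
  have Q: "markov_kernel Q" and \<nu>: "borel_prob \<nu>"
    using bmp by (auto simp: branching_markov_process_def)
  have fin: "(\<integral>\<^sup>+ x. ennreal ((f x - c)\<^sup>2) \<partial>measure_iter Q n \<nu>) < \<infinity>" for n
    by (rule le_less_trans[OF C(2)]) simp
  obtain i j where ij: "tree_dist u v = i + j"
    "integrable M (\<lambda>\<omega>. (f (X u \<omega>) - c) * (f (X v \<omega>) - c))"
    "ennreal (?E\<^sup>2) \<le> ?\<Phi> i * ?\<Phi> j"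
    by (rule pair_expectation_common_ancestor[OF bmp uv f fin])
  show "integrable M (\<lambda>\<omega>. (f (X u \<omega>) - c) * (f (X v \<omega>) - c))" by fact
  have \<Phi>_C: "?\<Phi> n \<le> ennreal C" for n
    by (rule order.trans[OF nn_integral_kernel_fun_sq_diff_le[OF Q \<nu> f] C(2)])
  have le_sqrt: "?E \<le> sqrt (a * b)" if "?\<Phi> i * ?\<Phi> j \<le> ennreal a * ennreal b" "0 \<le> a" "0 \<le> b" for a b
  proof (rule real_le_rsqrt)
    have "ennreal (?E\<^sup>2) \<le> ennreal (a * b)"
      using ij(3) that by (simp add: ennreal_mult)
    then show "?E\<^sup>2 \<le> a * b" using that by simp
  qed
  show "?E \<le> sqrt (\<delta> * C) + C * indicator {(u, v). tree_dist u v \<le> 2 * m} (u, v)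
        + C * indicator {(u, v). \<not> P (tree_height (common_ancestor u v))} (u, v)"
  proof (cases "tree_dist u v \<le> 2 * m \<or> \<not> P ?k")
    case True
    have "?E \<le> sqrt (C * C)"
      by (rule le_sqrt) (auto intro!: mult_mono \<Phi>_C C)
    also have "sqrt (C * C) = C" using C by simp
    also have "C \<le> C * indicator {(u, v). tree_dist u v \<le> 2 * m} (u, v)
        + C * indicator {(u, v). \<not> P (tree_height (common_ancestor u v))} (u, v)"
      using True C(1) by (auto simp: indicator_def)
    finally show ?thesis
      using real_sqrt_ge_zero[OF mult_nonneg_nonneg[OF \<delta>(1) C(1)]] by linarith
  next
    case False
    then have Pk: "P ?k" and "m < i \<or> m < j" using ij(1) by auto
    from this(2) have "?\<Phi> i * ?\<Phi> j \<le> ennreal \<delta> * ennreal C"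
    proof
      assume "m < i"
      then show ?thesis by (intro mult_mono \<delta>(2)[OF Pk] \<Phi>_C) auto
    next
      assume "m < j"
      then have "?\<Phi> j * ?\<Phi> i \<le> ennreal \<delta> * ennreal C"
        by (intro mult_mono \<delta>(2)[OF Pk] \<Phi>_C) auto
      then show ?thesis by (simp add: mult.commute)
    qed
    then have "?E \<le> sqrt (\<delta> * C)" by (rule le_sqrt) (use C \<delta> in auto)
    then show ?thesis using False by simp
  qed
qed

lemma tree_average_diff_sq:
  assumes "finite A" "A \<noteq> {}"
  shows "(tree_average A f X \<omega> - c)\<^sup>2
    = (\<Sum>p\<in>A \<times> A. (f (X (fst p) \<omega>) - c) * (f (X (snd p) \<omega>) - c)) / real (card (A \<times> A))"
proof -
  have pos: "real (card A) > 0" using assms by (simp add: card_gt_0_iff)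
  then have "tree_average A f X \<omega> - c = (\<Sum>u\<in>A. f (X u \<omega>) - c) / real (card A)"
    by (simp add: tree_average_def sum_subtractf field_simps)
  then show ?thesis
    by (simp add: power2_eq_square sum_product sum.cartesian_product case_prod_beta card_cartesian_product)
qed

text \<open>The squared average is a mean over \<open>A \<times> A\<close>; averaging the pair
  estimates turns the indicators into probabilities under \<open>uniform_pair A\<close>.\<close>

lemma tree_average_L2_le:
  assumes bmp: "branching_markov_process M Q \<nu> X"
    and A: "finite A" "A \<noteq> {}" "A \<subseteq> UHN"
    and f: "f \<in> borel_measurable borel"
    and C: "0 \<le> C" "\<And>n. (\<integral>\<^sup>+ x. ennreal ((f x - c)\<^sup>2) \<partial>measure_iter Q n \<nu>) \<le> ennreal C"
    and \<delta>: "0 \<le> \<delta>"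
      "\<And>k i. P k \<Longrightarrow> m < i \<Longrightarrow> (\<integral>\<^sup>+ x. ennreal ((kernel_fun Q i f x - c)\<^sup>2) \<partial>measure_iter Q k \<nu>) \<le> ennreal \<delta>"
  shows "(\<integral>\<omega>. (tree_average A f X \<omega> - c)\<^sup>2 \<partial>M)
    \<le> sqrt (\<delta> * C) + C * measure_pmf.prob (uniform_pair A) {(u, v). tree_dist u v \<le> 2 * m}
      + C * measure_pmf.prob (uniform_pair A) {(u, v). \<not> P (tree_height (common_ancestor u v))}"
proof -
  let ?h = "\<lambda>p \<omega>. (f (X (fst p) \<omega>) - c) * (f (X (snd p) \<omega>) - c)"
  let ?D = "{(u, v). tree_dist u v \<le> 2 * m}"
  let ?H = "{(u, v). \<not> P (tree_height (common_ancestor u v))}"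
  note le = pair_expectation_le[where P=P and m=m, OF bmp _ _ f C \<delta>]
  have pos: "0 < real (card (A \<times> A))" using A by (simp add: card_gt_0_iff card_cartesian_product)
  have prob: "measure_pmf.prob (uniform_pair A) S = (\<Sum>p\<in>A \<times> A. indicator S p) / real (card (A \<times> A))" for S
    using A by (simp add: uniform_pair_eq_pmf_of_set measure_pmf_of_set sum.If_cases indicator_def Int_def)
  have UHN: "fst p \<in> UHN" "snd p \<in> UHN" if "p \<in> A \<times> A" for p
    using that A by auto
  have int: "integrable M (?h p)" if "p \<in> A \<times> A" for p
    by (rule le(1)[OF UHN[OF that]])
  have "(\<integral>\<omega>. (tree_average A f X \<omega> - c)\<^sup>2 \<partial>M) = (\<Sum>p\<in>A \<times> A. \<integral>\<omega>. ?h p \<omega> \<partial>M) / real (card (A \<times> A))"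
    using int by (simp add: tree_average_diff_sq[OF A(1,2)] Bochner_Integration.integral_sum)
  also have "\<dots> \<le> (\<Sum>p\<in>A \<times> A. sqrt (\<delta> * C) + C * indicator ?D p + C * indicator ?H p) / real (card (A \<times> A))"
  proof (intro divide_right_mono sum_mono)
    fix p assume "p \<in> A \<times> A"
    from le(2)[OF UHN[OF this]]
    show "(\<integral>\<omega>. ?h p \<omega> \<partial>M) \<le> sqrt (\<delta> * C) + C * indicator ?D p + C * indicator ?H p"
      by (simp only: prod.collapse)
  qed simp
  also have "\<dots> = sqrt (\<delta> * C) + C * measure_pmf.prob (uniform_pair A) ?D
      + C * measure_pmf.prob (uniform_pair A) ?H"
    using pos by (simp add: prob sum.distrib add_divide_distrib del: card_cartesian_product flip: sum_distrib_left)
  finally show ?thesis .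
qed

text \<open>The pair estimates with constant 0 in place of \<open>c\<close> give integrability of
  every product in the expanded square.\<close>

lemma square_integrable_tree_average:
  assumes bmp: "branching_markov_process M Q \<nu> X"
    and A: "finite A" "A \<noteq> {}" "A \<subseteq> UHN"
    and f: "f \<in> borel_measurable borel"
    and fin: "\<And>n. (\<integral>\<^sup>+ x. ennreal ((f x)\<^sup>2) \<partial>measure_iter Q n \<nu>) < \<infinity>"
  shows "square_integrable M (tree_average A f X)"
  unfolding square_integrable_def
proof
  have X: "X u \<in> M \<rightarrow>\<^sub>M borel" if "u \<in> A" for u
    using bmp A that by (auto simp: branching_markov_process_def)
  show "tree_average A f X \<in> borel_measurable M"
    unfolding tree_average_def[abs_def]
    by (intro borel_measurable_divide borel_measurable_sum measurable_compose[OF X f]) auto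
  have fin0: "(\<integral>\<^sup>+ x. ennreal ((f x - 0)\<^sup>2) \<partial>measure_iter Q n \<nu>) < \<infinity>" for n
    using fin by simp
  have "integrable M (\<lambda>\<omega>. (f (X u \<omega>) - 0) * (f (X v \<omega>) - 0))" if "u \<in> A" "v \<in> A" for u v
    by (rule pair_expectation_common_ancestor[OF bmp _ _ f fin0, of u v]) (use that A in auto)
  then have "integrable M (\<lambda>\<omega>. (tree_average A f X \<omega> - 0)\<^sup>2)"
    unfolding tree_average_diff_sq[OF A(1,2)]
    by (intro integrable_divide Bochner_Integration.integrable_sum) auto
  then show "integrable M (\<lambda>\<omega>. (tree_average A f X \<omega>)\<^sup>2)" by simp
qed

section \<open>Decay uniformly over the generations\<close>

text \<open>Assumption (2), uniformly in the generation \<open>k\<close>; each of the conditions (B) implies it.\<close>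

definition uniformly_ergodic ::
  "('x::metric_space \<Rightarrow> 'x measure) \<Rightarrow> 'x measure \<Rightarrow> ('x \<Rightarrow> real) \<Rightarrow> real \<Rightarrow> bool" where
  "uniformly_ergodic Q \<nu> f c \<longleftrightarrow> (\<forall>\<delta>>0. \<exists>m. \<forall>i>m. \<forall>k.
    (\<integral>\<^sup>+ x. ennreal ((kernel_fun Q i f x - c)\<^sup>2) \<partial>measure_iter Q k \<nu>) \<le> ennreal \<delta>)"

lemma tendsto_0_ennreal_le:
  fixes F :: "nat \<Rightarrow> ennreal"
  assumes "F \<longlonglongrightarrow> 0" "0 < \<delta>"
  shows "\<exists>m. \<forall>i>m. F i \<le> ennreal \<delta>"
proof -
  have "\<forall>\<^sub>F i in sequentially. F i < ennreal \<delta>"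
    using assms by (intro order_tendstoD(2)) auto
  then show ?thesis unfolding eventually_sequentially by (meson less_imp_le)
qed

text \<open>Finitely many thresholds have a maximum. This handles bounded generations under
  tightness and the early generations under convergence in total variation.\<close>

lemma tendsto_0_ennreal_le_finite:
  fixes F :: "nat \<Rightarrow> nat \<Rightarrow> ennreal"
  assumes "\<And>k. F k \<longlonglongrightarrow> 0" "0 < \<delta>"
  shows "\<exists>m. \<forall>k\<le>K. \<forall>i>m. F k i \<le> ennreal \<delta>"
proof -
  obtain m where m: "\<And>k i. m k < i \<Longrightarrow> F k i \<le> ennreal \<delta>"
    using tendsto_0_ennreal_le[OF assms] by metis
  have "F k i \<le> ennreal \<delta>" if "k \<le> K" "Max (m ` {..K}) < i" for k i
  proof (rule m)
    have "m k \<le> Max (m ` {..K})" using that by (intro Max_ge) auto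
    then show "m k < i" using that by simp
  qed
  then show ?thesis by blast
qed

lemma uniformly_ergodic_invariant:
  assumes "invariant_measure Q \<nu>"
    and "(\<lambda>n. \<integral>\<^sup>+ x. ennreal ((kernel_fun Q n f x - c)\<^sup>2) \<partial>measure_iter Q 0 \<nu>) \<longlonglongrightarrow> 0"
  shows "uniformly_ergodic Q \<nu> f c"
  unfolding uniformly_ergodic_def measure_iter_invariant[OF assms(1)]
  using tendsto_0_ennreal_le[OF assms(2)] by simp

section \<open>Uniform decay from convergence in total variation\<close>

lemma measure_le_tv_dist:
  assumes "borel_prob \<mu>" "borel_prob \<nu>" "S \<in> sets borel"
  shows "measure \<mu> S \<le> measure \<nu> S + tv_dist \<mu> \<nu>"
proof -
  interpret \<mu>: prob_space \<mu> using assms by (simp add: borel_prob_def)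
  interpret \<nu>: prob_space \<nu> using assms by (simp add: borel_prob_def)
  \<comment> \<open>A real supremum is an upper bound only for a bounded family.\<close>
  have "bdd_above ((\<lambda>B. \<bar>measure \<mu> B - measure \<nu> B\<bar>) ` sets borel)"
  proof (rule bdd_aboveI2)
    show "\<bar>measure \<mu> B - measure \<nu> B\<bar> \<le> 1" for B
      using \<mu>.prob_le_1[of B] \<nu>.prob_le_1[of B] measure_nonneg[of \<mu> B] measure_nonneg[of \<nu> B]
      by linarith
  qed
  then have "\<bar>measure \<mu> S - measure \<nu> S\<bar> \<le> tv_dist \<mu> \<nu>"
    unfolding tv_dist_def using assms(3) by (intro cSUP_upper)
  then show ?thesis by linarith
qed

text \<open>Splits at the level \<open>\<epsilon>\<close>: below it \<open>g\<close> is small, above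
  it \<open>g\<close> is at most \<open>D\<close>. Total variation controls probabilities of events,
  so integrals are reduced to these.\<close>

lemma nn_integral_le_of_measure:
  fixes g :: "'x::metric_space \<Rightarrow> real"
  assumes N: "borel_prob N" and g: "g \<in> borel_measurable borel" "\<And>x. g x \<le> D"
    and pos: "0 \<le> \<epsilon>" "0 \<le> D"
  shows "(\<integral>\<^sup>+ x. ennreal (g x) \<partial>N) \<le> ennreal (\<epsilon> + D * measure N {x. \<epsilon> \<le> g x})"
proof -
  interpret prob_space N using N by (simp add: borel_prob_def)
  let ?S = "{x. \<epsilon> \<le> g x}"
  have "?S = {x \<in> space borel. \<epsilon> \<le> g x}" by simp
  also have "\<dots> \<in> sets borel" using g(1) by measurable
  finally have S[measurable]: "?S \<in> sets N" using N by (simp add: borel_prob_def)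
  have "(\<integral>\<^sup>+ x. ennreal (g x) \<partial>N) \<le> (\<integral>\<^sup>+ x. ennreal \<epsilon> + ennreal D * indicator ?S x \<partial>N)"
    using g(2) pos by (intro nn_integral_mono)
      (auto simp: indicator_def intro!: ennreal_leI add_increasing simp flip: ennreal_plus)
  also have "\<dots> = ennreal \<epsilon> + ennreal D * emeasure N ?S"
    using S by (simp add: nn_integral_add nn_integral_cmult_indicator emeasure_space_1)
  also have "\<dots> = ennreal (\<epsilon> + D * measure N ?S)"
    using pos by (simp add: emeasure_eq_measure ennreal_mult)
  finally show ?thesis .
qed

lemma Markov_inequality_borel_prob:
  fixes g :: "'x::metric_space \<Rightarrow> real"
  assumes N: "borel_prob N" and g: "g \<in> borel_measurable borel" "\<And>x. 0 \<le> g x"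
    and pos: "0 < \<epsilon>" "0 \<le> \<eta>" and le: "(\<integral>\<^sup>+ x. ennreal (g x) \<partial>N) \<le> ennreal (\<epsilon> * \<eta>)"
  shows "measure N {x. \<epsilon> \<le> g x} \<le> \<eta>"
proof -
  interpret prob_space N using N by (simp add: borel_prob_def)
  have gN[measurable]: "g \<in> borel_measurable N" using N g by (simp add: borel_prob_measurable)
  have sp: "space N = UNIV" using N sets_eq_imp_space_eq[of N borel] by (simp add: borel_prob_def)
  \<comment> \<open>Markov's inequality is applied at level 1, so \<open>g\<close> is rescaled by
    \<open>1 / \<epsilon>\<close>.\<close>
  have "1 \<le> ennreal (1 / \<epsilon>) * ennreal (g x) \<longleftrightarrow> \<epsilon> \<le> g x" for x
    using pos g(2)[of x] by (simp add: ennreal_ge_1 field_simps flip: ennreal_mult)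
  then have "emeasure N {x. \<epsilon> \<le> g x} = emeasure N {x \<in> space N. 1 \<le> ennreal (1 / \<epsilon>) * ennreal (g x)}"
    by (simp add: sp)
  also have "\<dots> \<le> ennreal (1 / \<epsilon>) * (\<integral>\<^sup>+ x. ennreal (g x) * indicator (space N) x \<partial>N)"
    by (rule nn_integral_Markov_inequality) simp_all
  also have "(\<integral>\<^sup>+ x. ennreal (g x) * indicator (space N) x \<partial>N) = (\<integral>\<^sup>+ x. ennreal (g x) \<partial>N)"
    by (rule nn_integral_cong) simp
  also have "ennreal (1 / \<epsilon>) * \<dots> \<le> ennreal (1 / \<epsilon>) * ennreal (\<epsilon> * \<eta>)"
    using le by (rule mult_left_mono) simp
  also have "\<dots> = ennreal \<eta>"
    using pos by (simp flip: ennreal_mult)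
  finally show ?thesis using pos by (simp add: emeasure_eq_measure)
qed

text \<open>Up to generation \<open>K\<close> the decay is a finite maximum. Beyond it the decay
  under \<open>\<mu>\<close> is transferred: Markov's inequality bounds the
  \<open>\<mu>\<close>-probability of a large deviation, total variation carries this over to
  generation \<open>k\<close>, and boundedness of \<open>f\<close> turns it back into an
  integral.\<close>

lemma uniformly_ergodic_tv:
  assumes Q: "markov_kernel Q" and \<nu>: "borel_prob \<nu>" and f: "f \<in> borel_measurable borel"
    and \<mu>: "invariant_measure Q \<mu>"
    and tv: "(\<lambda>n. tv_dist (measure_iter Q n \<nu>) \<mu>) \<longlonglongrightarrow> 0"
    and bdd: "bounded (range f)"
    and lim_\<mu>: "(\<lambda>n. \<integral>\<^sup>+ x. ennreal ((kernel_fun Q n f x - c)\<^sup>2) \<partial>\<mu>) \<longlonglongrightarrow> 0"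
    and lim: "\<And>k. (\<lambda>n. \<integral>\<^sup>+ x. ennreal ((kernel_fun Q n f x - c)\<^sup>2) \<partial>measure_iter Q k \<nu>) \<longlonglongrightarrow> 0"
  shows "uniformly_ergodic Q \<nu> f c"
  unfolding uniformly_ergodic_def
proof (intro allI impI)
  fix \<delta> :: real assume \<delta>: "0 < \<delta>"
  obtain B where B: "\<And>x. \<bar>f x\<bar> \<le> B"
    using bdd by (auto simp: bounded_iff)
  define D where "D = (B + \<bar>c\<bar>)\<^sup>2"
  have D0: "0 \<le> D" by (simp add: D_def)
  have D: "(kernel_fun Q i f x - c)\<^sup>2 \<le> D" for i x
  proof -
    interpret K: prob_space "kernel_pow Q i x"
      using markov_kernel_borel_prob[OF markov_kernel_pow[OF Q]] by (simp add: borel_prob_def)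
    have "f \<in> borel_measurable (kernel_pow Q i x)"
      using f markov_kernel_borel_prob[OF markov_kernel_pow[OF Q]] by (simp add: borel_prob_measurable)
    then have "integrable (kernel_pow Q i x) f"
      using B by (intro K.integrable_const_bound[of _ B]) auto
    then have "\<bar>kernel_fun Q i f x\<bar> \<le> B"
      unfolding kernel_fun_def abs_le_iff
      using B K.integral_le_const[of f B] K.integral_ge_const[of f "- B"]
      by (auto simp: abs_le_iff minus_le_iff)
    then have "\<bar>kernel_fun Q i f x - c\<bar> \<le> B + \<bar>c\<bar>" by linarith
    then show ?thesis unfolding D_def by (metis abs_ge_zero power2_abs power_mono)
  qed
  \<comment> \<open>Chosen so that \<open>\<delta> / 3 + 2 * D * \<eta>\<close> is at most
    \<open>\<delta>\<close>: one \<open>\<eta>\<close> comes from Markov's inequality and one from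
    total variation. Using \<open>D + 1\<close> avoids division by 0.\<close>
  define \<eta> where "\<eta> = \<delta> / (3 * (D + 1))"
  have \<eta>: "0 < \<eta>" using \<delta> D0 by (simp add: \<eta>_def)
  have D\<eta>: "D * \<eta> \<le> \<delta> / 3" using \<delta> D0 by (simp add: \<eta>_def field_simps)
  obtain K where K: "\<And>k. K \<le> k \<Longrightarrow> tv_dist (measure_iter Q k \<nu>) \<mu> < \<eta>"
    using order_tendstoD(2)[OF tv \<eta>] by (auto simp: eventually_sequentially)
  have "0 < \<delta> / 3 * \<eta>" using \<delta> \<eta> by simp
  then obtain m1 where m1: "\<And>i. m1 < i \<Longrightarrow>
      (\<integral>\<^sup>+ x. ennreal ((kernel_fun Q i f x - c)\<^sup>2) \<partial>\<mu>) \<le> ennreal (\<delta> / 3 * \<eta>)"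
    using tendsto_0_ennreal_le[OF lim_\<mu>] by blast
  obtain m2 where m2: "\<And>k i. k \<le> K \<Longrightarrow> m2 < i \<Longrightarrow>
      (\<integral>\<^sup>+ x. ennreal ((kernel_fun Q i f x - c)\<^sup>2) \<partial>measure_iter Q k \<nu>) \<le> ennreal \<delta>"
    using tendsto_0_ennreal_le_finite[of "\<lambda>k n. \<integral>\<^sup>+ x. ennreal ((kernel_fun Q n f x - c)\<^sup>2) \<partial>measure_iter Q k \<nu>", OF lim \<delta>]
    by blast
  have "(\<integral>\<^sup>+ x. ennreal ((kernel_fun Q i f x - c)\<^sup>2) \<partial>measure_iter Q k \<nu>) \<le> ennreal \<delta>"
    if i: "max m1 m2 < i" for i k
  proof (cases "k \<le> K")
    case True
    then show ?thesis using m2 i by simp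
  next
    case False
    let ?g = "\<lambda>x. (kernel_fun Q i f x - c)\<^sup>2"
    let ?S = "{x. \<delta> / 3 \<le> ?g x}"
    let ?N = "measure_iter Q k \<nu>"
    have g[measurable]: "?g \<in> borel_measurable borel"
      using measurable_kernel_fun[OF Q f] by simp
    have N: "borel_prob ?N" and \<mu>': "borel_prob \<mu>"
      using borel_prob_measure_iter[OF Q \<nu>] \<mu> by (auto simp: invariant_measure_def)
    have S: "?S \<in> sets borel"
      using borel_measurable_le[OF borel_measurable_const g, of "\<delta> / 3"] by simp
    have "measure \<mu> ?S \<le> \<eta>"
      using \<delta> \<eta> m1[of i] i by (intro Markov_inequality_borel_prob[OF \<mu>' g]) auto
    then have "measure ?N ?S \<le> \<eta> + \<eta>"
      using measure_le_tv_dist[OF N \<mu>' S] K[of k] False by linarith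
    then have "D * measure ?N ?S \<le> D * (\<eta> + \<eta>)"
      using D0 by (rule mult_left_mono)
    then have "\<delta> / 3 + D * measure ?N ?S \<le> \<delta>"
      using D\<eta> by (simp add: distrib_left)
    moreover have "(\<integral>\<^sup>+ x. ennreal (?g x) \<partial>?N) \<le> ennreal (\<delta> / 3 + D * measure ?N ?S)"
      using \<delta> D0 by (intro nn_integral_le_of_measure[OF N g D]) auto
    ultimately show ?thesis using order.trans ennreal_leI by blast
  qed
  then show "\<exists>m. \<forall>i>m. \<forall>k.
    (\<integral>\<^sup>+ x. ennreal ((kernel_fun Q i f x - c)\<^sup>2) \<partial>measure_iter Q k \<nu>) \<le> ennreal \<delta>"
    by blast
qed

section \<open>Uniform decay from domination, and the limit constant\<close>

text \<open>Squaring and integrating the pointwise bound gives \<open>(a i)\<^sup>2 * G\<close>,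
  where \<open>G\<close> bounds the second moments of \<open>g\<close> in all generations. The
  points where the pointwise bound is not assumed form a null set.\<close>

lemma uniformly_ergodic_dominated:
  assumes Q: "markov_kernel Q" and \<nu>: "borel_prob \<nu>" and f: "f \<in> borel_measurable borel"
    and fin: "\<And>n. (\<integral>\<^sup>+ x. ennreal ((f x)\<^sup>2) \<partial>measure_iter Q n \<nu>) < \<infinity>"
    and g: "g \<in> borel_measurable borel" "\<And>x. 0 \<le> g x"
    and g2: "(SUP k. \<integral>\<^sup>+ x. ennreal ((g x)\<^sup>2) \<partial>measure_iter Q k \<nu>) < \<infinity>"
    and a: "\<And>n. 0 < a n" "a \<longlonglongrightarrow> 0"
    and le: "\<And>n x. integrable (kernel_pow Q n x) f \<Longrightarrow> \<bar>kernel_fun Q n f x - c\<bar> \<le> a n * g x"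
  shows "uniformly_ergodic Q \<nu> f c"
  unfolding uniformly_ergodic_def
proof (intro allI impI)
  fix \<delta> :: real assume \<delta>: "0 < \<delta>"
  obtain G where G: "0 \<le> G" "(SUP k. \<integral>\<^sup>+ x. ennreal ((g x)\<^sup>2) \<partial>measure_iter Q k \<nu>) = ennreal G"
    using g2 by (cases "SUP k. \<integral>\<^sup>+ x. ennreal ((g x)\<^sup>2) \<partial>measure_iter Q k \<nu>") auto
  have bound: "(\<integral>\<^sup>+ x. ennreal ((kernel_fun Q i f x - c)\<^sup>2) \<partial>measure_iter Q k \<nu>) \<le> ennreal ((a i)\<^sup>2 * G)"
    for i k
  proof -
    let ?N = "measure_iter Q k \<nu>"
    have gN[measurable]: "g \<in> borel_measurable ?N"
      using g borel_prob_measure_iter[OF Q \<nu>] by (simp add: borel_prob_measurable)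
    have "(\<integral>\<^sup>+ x. ennreal ((kernel_fun Q i f x - c)\<^sup>2) \<partial>?N)
      \<le> (\<integral>\<^sup>+ x. ennreal ((a i)\<^sup>2) * ennreal ((g x)\<^sup>2) \<partial>?N)"
    proof (rule nn_integral_mono_AE)
      show "AE x in ?N. ennreal ((kernel_fun Q i f x - c)\<^sup>2) \<le> ennreal ((a i)\<^sup>2) * ennreal ((g x)\<^sup>2)"
        using AE_integrable_kernel_pow[OF Q \<nu> f fin, of i k]
      proof eventually_elim
        case (elim x)
        have "\<bar>kernel_fun Q i f x - c\<bar>\<^sup>2 \<le> (a i * g x)\<^sup>2"
          using le[OF elim] by (rule power_mono) simp
        then show ?case by (simp add: power_mult_distrib ennreal_leI flip: ennreal_mult)
      qed
    qed
    also have "\<dots> = ennreal ((a i)\<^sup>2) * (\<integral>\<^sup>+ x. ennreal ((g x)\<^sup>2) \<partial>?N)"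
      by (rule nn_integral_cmult) simp
    also have "\<dots> \<le> ennreal ((a i)\<^sup>2) * ennreal G"
      unfolding G(2)[symmetric] by (intro mult_left_mono SUP_upper) auto
    finally show ?thesis using G(1) by (simp add: ennreal_mult)
  qed
  have "(\<lambda>i. ennreal ((a i)\<^sup>2 * G)) \<longlonglongrightarrow> ennreal (0\<^sup>2 * G)"
    by (intro tendsto_intros a)
  then have "\<exists>m. \<forall>i>m. ennreal ((a i)\<^sup>2 * G) \<le> ennreal \<delta>"
    using \<delta> by (intro tendsto_0_ennreal_le) simp_all
  then show "\<exists>m. \<forall>i>m. \<forall>k.
    (\<integral>\<^sup>+ x. ennreal ((kernel_fun Q i f x - c)\<^sup>2) \<partial>measure_iter Q k \<nu>) \<le> ennreal \<delta>"
    using bound order.trans by blast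
qed

text \<open>Two constants approximated in mean square by the same functions coincide. Under
  domination this identifies \<open>c\<close> with the \<open>\<mu>\<close>-mean of
  \<open>f\<close>.\<close>

lemma uniformly_ergodic_limit_unique:
  assumes Q: "markov_kernel Q" and \<nu>: "borel_prob \<nu>" and f: "f \<in> borel_measurable borel"
    and c': "uniformly_ergodic Q \<nu> f c'"
    and lim: "(\<lambda>n. \<integral>\<^sup>+ x. ennreal ((kernel_fun Q n f x - c)\<^sup>2) \<partial>measure_iter Q 0 \<nu>) \<longlonglongrightarrow> 0"
  shows "c = c'"
proof (rule ccontr)
  assume "c \<noteq> c'"
  interpret prob_space \<nu> using \<nu> by (simp add: borel_prob_def)
  \<comment> \<open>The estimate below bounds \<open>(c - c')\<^sup>2\<close> by
    \<open>4 * \<delta>\<close>, hence the 5.\<close>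
  define \<delta> where "\<delta> = (c - c')\<^sup>2 / 5"
  have \<delta>: "0 < \<delta>" using \<open>c \<noteq> c'\<close> by (simp add: \<delta>_def)
  obtain m where m: "\<And>i. m < i \<Longrightarrow> (\<integral>\<^sup>+ x. ennreal ((kernel_fun Q i f x - c)\<^sup>2) \<partial>measure_iter Q 0 \<nu>) \<le> ennreal \<delta>"
    using tendsto_0_ennreal_le[OF lim \<delta>] by blast
  obtain m' where m': "\<And>i k. m' < i \<Longrightarrow> (\<integral>\<^sup>+ x. ennreal ((kernel_fun Q i f x - c')\<^sup>2) \<partial>measure_iter Q k \<nu>) \<le> ennreal \<delta>"
    using c' \<delta> unfolding uniformly_ergodic_def by blast
  define i where "i = Suc (max m m')"
  let ?P = "kernel_fun Q i f"
  have [measurable]: "?P \<in> borel_measurable \<nu>"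
    using measurable_kernel_fun_iter[OF Q \<nu> f, of i 0] by simp
  have "ennreal ((c - c')\<^sup>2) = (\<integral>\<^sup>+ x. ennreal ((c - c')\<^sup>2) \<partial>\<nu>)"
    by (simp add: emeasure_space_1)
  also have "\<dots> \<le> (\<integral>\<^sup>+ x. 2 * ennreal ((?P x - c)\<^sup>2) + 2 * ennreal ((?P x - c')\<^sup>2) \<partial>\<nu>)"
  proof (rule nn_integral_mono)
    fix x
    have "(c - c')\<^sup>2 \<le> 2 * (?P x - c)\<^sup>2 + 2 * (?P x - c')\<^sup>2"
      using zero_le_power2[of "(?P x - c) + (?P x - c')"] by (simp add: power2_eq_square algebra_simps)
    then have "ennreal ((c - c')\<^sup>2) \<le> ennreal (2 * (?P x - c)\<^sup>2 + 2 * (?P x - c')\<^sup>2)"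
      by (rule ennreal_leI)
    then show "ennreal ((c - c')\<^sup>2) \<le> 2 * ennreal ((?P x - c)\<^sup>2) + 2 * ennreal ((?P x - c')\<^sup>2)"
      by (simp add: ennreal_mult)
  qed
  also have "\<dots> = 2 * (\<integral>\<^sup>+ x. ennreal ((?P x - c)\<^sup>2) \<partial>\<nu>) + 2 * (\<integral>\<^sup>+ x. ennreal ((?P x - c')\<^sup>2) \<partial>\<nu>)"
    by (simp add: nn_integral_add nn_integral_cmult)
  also have "\<dots> \<le> 2 * ennreal \<delta> + 2 * ennreal \<delta>"
    using m[of i] m'[of i 0] by (intro add_mono mult_left_mono) (auto simp: i_def)
  also have "\<dots> = ennreal (4 * \<delta>)"
    using \<delta> by (simp add: ennreal_mult flip: distrib_right)
  finally show False
    using \<delta> by (simp add: \<delta>_def)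
qed

section \<open>Convergence of tree averages\<close>

text \<open>A common form of (A) and (B): up to probability \<open>\<eta>\<close>, the common
  ancestor lies in a set \<open>P\<close> of generations on which the decay is uniform.
  \<open>P\<close> may depend on \<open>\<eta>\<close>, as tightness requires.\<close>

lemma tendsto_L2_tree_average:
  fixes A :: "nat \<Rightarrow> nat list set"
  assumes bmp: "branching_markov_process M Q \<nu> X"
    and A: "\<And>n. finite (A n) \<and> A n \<noteq> {} \<and> A n \<subseteq> UHN"
    and f: "f \<in> borel_measurable borel"
    and sparse: "\<And>k. (\<lambda>n. measure_pmf.prob (uniform_pair (A n)) {(u, v). tree_dist u v \<le> k}) \<longlonglongrightarrow> 0"
    and cond1: "(SUP n. \<integral>\<^sup>+ x. ennreal ((f x)\<^sup>2) \<partial>measure_iter Q n \<nu>) < \<infinity>"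
    and P: "\<And>\<eta>. 0 < \<eta> \<Longrightarrow> \<exists>P.
      (\<forall>\<^sub>F n in sequentially.
        measure_pmf.prob (uniform_pair (A n)) {(u, v). \<not> P (tree_height (common_ancestor u v))} < \<eta>) \<and>
      (\<forall>\<delta>>0. \<exists>m. \<forall>i>m. \<forall>k. P k \<longrightarrow>
        (\<integral>\<^sup>+ x. ennreal ((kernel_fun Q i f x - c)\<^sup>2) \<partial>measure_iter Q k \<nu>) \<le> ennreal \<delta>)"
  shows "tendsto_L2 M (\<lambda>n. tree_average (A n) f X) (\<lambda>_. c)"
proof -
  have Q: "markov_kernel Q" and \<nu>: "borel_prob \<nu>" and "prob_space M"
    using bmp by (auto simp: branching_markov_process_def)
  interpret M: prob_space M by fact
  obtain S where S: "0 \<le> S" "(SUP n. \<integral>\<^sup>+ x. ennreal ((f x)\<^sup>2) \<partial>measure_iter Q n \<nu>) = ennreal S"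
    using cond1 by (cases "SUP n. \<integral>\<^sup>+ x. ennreal ((f x)\<^sup>2) \<partial>measure_iter Q n \<nu>") auto
  have f2: "(\<integral>\<^sup>+ x. ennreal ((f x)\<^sup>2) \<partial>measure_iter Q n \<nu>) \<le> ennreal S" for n
    unfolding S(2)[symmetric] by (rule SUP_upper) simp
  \<comment> \<open>The last two terms come from bounding the square of \<open>f - c\<close>; the
    summand 1 gives \<open>1 \<le> C\<close>, which permits division by \<open>C\<close> and
    replacing \<open>C\<close> by its square under the root.\<close>
  define C where "C = 1 + 2 * S + 2 * c\<^sup>2"
  have C1: "1 \<le> C" using S(1) by (simp add: C_def)
  have C: "(\<integral>\<^sup>+ x. ennreal ((f x - c)\<^sup>2) \<partial>measure_iter Q n \<nu>) \<le> ennreal C" for n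
  proof -
    let ?N = "measure_iter Q n \<nu>"
    have N: "borel_prob ?N" by (rule borel_prob_measure_iter[OF Q \<nu>])
    interpret N: prob_space ?N using N by (simp add: borel_prob_def)
    have [measurable]: "f \<in> borel_measurable ?N" using N f by (simp add: borel_prob_measurable)
    have "(\<integral>\<^sup>+ x. ennreal ((f x - c)\<^sup>2) \<partial>?N) \<le> (\<integral>\<^sup>+ x. 2 * ennreal ((f x)\<^sup>2) + ennreal (2 * c\<^sup>2) \<partial>?N)"
    proof (rule nn_integral_mono)
      fix x
      have "(f x - c)\<^sup>2 \<le> 2 * (f x)\<^sup>2 + 2 * c\<^sup>2"
        using zero_le_power2[of "f x + c"] by (simp add: power2_eq_square algebra_simps)
      then have "ennreal ((f x - c)\<^sup>2) \<le> ennreal (2 * (f x)\<^sup>2 + 2 * c\<^sup>2)"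
        by (rule ennreal_leI)
      then show "ennreal ((f x - c)\<^sup>2) \<le> 2 * ennreal ((f x)\<^sup>2) + ennreal (2 * c\<^sup>2)"
        by (simp add: ennreal_mult)
    qed
    also have "\<dots> = 2 * (\<integral>\<^sup>+ x. ennreal ((f x)\<^sup>2) \<partial>?N) + ennreal (2 * c\<^sup>2)"
      by (simp add: nn_integral_add nn_integral_cmult N.emeasure_space_1)
    also have "\<dots> \<le> 2 * ennreal S + ennreal (2 * c\<^sup>2)"
      by (intro add_mono mult_left_mono f2) auto
    also have "\<dots> = ennreal (2 * S + 2 * c\<^sup>2)"
      using S(1) by (simp add: ennreal_mult)
    also have "\<dots> \<le> ennreal C" by (rule ennreal_leI) (simp add: C_def)
    finally show ?thesis .
  qed
  have sq: "square_integrable M (tree_average (A n) f X)" for n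
    using A[of n] by (intro square_integrable_tree_average[OF bmp _ _ _ f])
      (auto intro: le_less_trans[OF f2])
  have "(\<lambda>n. \<integral>\<omega>. (tree_average (A n) f X \<omega> - c)\<^sup>2 \<partial>M) \<longlonglongrightarrow> 0"
  proof (rule LIMSEQ_I)
    fix \<epsilon> :: real assume \<epsilon>: "0 < \<epsilon>"
    \<comment> \<open>Each of the three error terms becomes at most \<open>\<epsilon> / 4\<close>;
      for the root term this requires decay to the level \<open>\<eta>\<^sup>2\<close>.\<close>
    define \<eta> where "\<eta> = \<epsilon> / (4 * C)"
    have \<eta>: "0 < \<eta>" and C\<eta>: "C * \<eta> = \<epsilon> / 4" using \<epsilon> C1 by (auto simp: \<eta>_def)
    obtain P where P1: "\<forall>\<^sub>F n in sequentially.
        measure_pmf.prob (uniform_pair (A n)) {(u, v). \<not> P (tree_height (common_ancestor u v))} < \<eta>"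
      and P2: "\<And>\<delta>. 0 < \<delta> \<Longrightarrow> \<exists>m. \<forall>i>m. \<forall>k. P k \<longrightarrow>
        (\<integral>\<^sup>+ x. ennreal ((kernel_fun Q i f x - c)\<^sup>2) \<partial>measure_iter Q k \<nu>) \<le> ennreal \<delta>"
      using P[OF \<eta>] by blast
    obtain m where m: "\<And>k i. P k \<Longrightarrow> m < i \<Longrightarrow>
        (\<integral>\<^sup>+ x. ennreal ((kernel_fun Q i f x - c)\<^sup>2) \<partial>measure_iter Q k \<nu>) \<le> ennreal (\<eta>\<^sup>2)"
      using P2[of "\<eta>\<^sup>2"] \<eta> by auto
    have "sqrt (\<eta>\<^sup>2 * C) \<le> sqrt (\<eta>\<^sup>2 * C\<^sup>2)"
      using C1 by (intro real_sqrt_le_mono mult_left_mono self_le_power) auto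
    also have "\<dots> = \<epsilon> / 4" using \<eta> C1 C\<eta> by (simp add: real_sqrt_mult mult.commute)
    finally have sqrt: "sqrt (\<eta>\<^sup>2 * C) \<le> \<epsilon> / 4" .
    have "\<forall>\<^sub>F n in sequentially. (\<integral>\<omega>. (tree_average (A n) f X \<omega> - c)\<^sup>2 \<partial>M) < \<epsilon>"
      using P1 order_tendstoD(2)[OF sparse \<eta>, of "2 * m"]
    proof eventually_elim
      case (elim n)
      let ?p = "measure_pmf.prob (uniform_pair (A n)) {(u, v). \<not> P (tree_height (common_ancestor u v))}"
      let ?q = "measure_pmf.prob (uniform_pair (A n)) {(u, v). tree_dist u v \<le> 2 * m}"
      have "(\<integral>\<omega>. (tree_average (A n) f X \<omega> - c)\<^sup>2 \<partial>M) \<le> sqrt (\<eta>\<^sup>2 * C) + C * ?q + C * ?p"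
        by (rule tree_average_L2_le[OF bmp _ _ _ f _ C]) (use A[of n] C1 m in auto)
      moreover have "C * ?p \<le> C * \<eta>" "C * ?q \<le> C * \<eta>"
        using elim C1 by (auto intro!: mult_left_mono)
      ultimately show ?case using sqrt C\<eta> \<epsilon> by linarith
    qed
    then show "\<exists>n0. \<forall>n\<ge>n0. norm ((\<integral>\<omega>. (tree_average (A n) f X \<omega> - c)\<^sup>2 \<partial>M) - 0) < \<epsilon>"
      by (simp add: eventually_sequentially)
  qed
  then show ?thesis
    using sq by (simp add: tendsto_L2_def square_integrable_def)
qed

theorem theorem2p2:
  fixes A :: "nat \<Rightarrow> nat list set"
    and M :: "'w measure"
    and Q :: "'x::metric_space \<Rightarrow> 'x measure"
    and \<nu> :: "'x measure"
    and X :: "nat list \<Rightarrow> 'w \<Rightarrow> 'x"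
    and f :: "'x \<Rightarrow> real"
    and c :: real
  assumes A: "\<And>n. finite (A n) \<and> A n \<noteq> {} \<and> A n \<subseteq> UHN"
    and sparse: "\<And>k::nat. (\<lambda>n. measure_pmf.prob (uniform_pair (A n)) {(u, v). tree_dist u v \<le> k})
                   \<longlonglongrightarrow> 0"
    and bmp: "branching_markov_process M Q \<nu> X"
    and f: "f \<in> borel_measurable borel"
    and cond1: "(SUP n. \<integral>\<^sup>+ x. ennreal ((f x)\<^sup>2) \<partial>measure_iter Q n \<nu>) < \<infinity>"
    and cond2: "\<And>k. (\<lambda>n. \<integral>\<^sup>+ x. ennreal ((kernel_fun Q n f x - c)\<^sup>2) \<partial>measure_iter Q k \<nu>)
                   \<longlonglongrightarrow> 0"
    and A_or_B:
      "(\<forall>\<epsilon>>0. \<exists>k. \<forall>\<^sub>F n in sequentially.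
          measure_pmf.prob (uniform_pair (A n)) {(u, v). tree_height (common_ancestor u v) > k} < \<epsilon>)
       \<or>
       (invariant_measure Q \<nu>
        \<or>
        (\<exists>\<mu>. invariant_measure Q \<mu> \<and>
             (\<lambda>n. tv_dist (measure_iter Q n \<nu>) \<mu>) \<longlonglongrightarrow> 0 \<and>
             bounded (range f) \<and>
             (\<lambda>n. \<integral>\<^sup>+ x. ennreal ((kernel_fun Q n f x - c)\<^sup>2) \<partial>\<mu>) \<longlonglongrightarrow> 0)
        \<or>
        (\<exists>\<mu>. invariant_measure Q \<mu> \<and> (\<forall>\<mu>'. invariant_measure Q \<mu>' \<longrightarrow> \<mu>' = \<mu>) \<and>
             integrable \<mu> f \<and>
             (\<exists>(g :: 'x \<Rightarrow> real) (a :: nat \<Rightarrow> real).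
                g \<in> borel_measurable borel \<and> (\<forall>x. 0 \<le> g x) \<and>
                (SUP k. \<integral>\<^sup>+ x. ennreal ((g x)\<^sup>2) \<partial>measure_iter Q k \<nu>) < \<infinity> \<and>
                (\<forall>n. 0 < a n) \<and> a \<longlonglongrightarrow> 0 \<and>
                (\<forall>n x. integrable (kernel_pow Q n x) f \<longrightarrow>
                   \<bar>kernel_fun Q n f x - (\<integral>y. f y \<partial>\<mu>)\<bar> \<le> a n * g x))))"
  shows "tendsto_L2 M (\<lambda>n. tree_average (A n) f X) (\<lambda>_. c)"
proof -
  have Q: "markov_kernel Q" and \<nu>: "borel_prob \<nu>"
    using bmp by (auto simp: branching_markov_process_def)
  have fin: "(\<integral>\<^sup>+ x. ennreal ((f x)\<^sup>2) \<partial>measure_iter Q n \<nu>) < \<infinity>" for n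
    by (rule le_less_trans[OF SUP_upper cond1]) simp
  note core = tendsto_L2_tree_average[OF bmp A f sparse cond1]
  \<comment> \<open>Under (B) every generation is good, so the exceptional event is empty.\<close>
  have unif: ?thesis if "uniformly_ergodic Q \<nu> f c"
    using that by (intro core exI[of _ "\<lambda>_. True"]) (auto simp: uniformly_ergodic_def)
  from A_or_B show ?thesis
  proof (elim disjE exE conjE)
    assume tight: "\<forall>\<epsilon>>0. \<exists>k. \<forall>\<^sub>F n in sequentially.
      measure_pmf.prob (uniform_pair (A n)) {(u, v). tree_height (common_ancestor u v) > k} < \<epsilon>"
    show ?thesis
    proof (rule core)
      fix \<eta> :: real assume "0 < \<eta>"
      then obtain K where K: "\<forall>\<^sub>F n in sequentially.
        measure_pmf.prob (uniform_pair (A n)) {(u, v). tree_height (common_ancestor u v) > K} < \<eta>"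
        using tight by blast
      \<comment> \<open>Under (A) the good generations are those up to \<open>K\<close>, and being
        finitely many they share a threshold.\<close>
      moreover have "\<exists>m. \<forall>i>m. \<forall>k. k \<le> K \<longrightarrow>
        (\<integral>\<^sup>+ x. ennreal ((kernel_fun Q i f x - c)\<^sup>2) \<partial>measure_iter Q k \<nu>) \<le> ennreal \<delta>"
        if "0 < \<delta>" for \<delta>
        using tendsto_0_ennreal_le_finite[of
            "\<lambda>k n. \<integral>\<^sup>+ x. ennreal ((kernel_fun Q n f x - c)\<^sup>2) \<partial>measure_iter Q k \<nu>", OF cond2 that]
        by blast
      ultimately show "\<exists>P. (\<forall>\<^sub>F n in sequentially.
        measure_pmf.prob (uniform_pair (A n)) {(u, v). \<not> P (tree_height (common_ancestor u v))} < \<eta>) \<and>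
        (\<forall>\<delta>>0. \<exists>m. \<forall>i>m. \<forall>k. P k \<longrightarrow>
          (\<integral>\<^sup>+ x. ennreal ((kernel_fun Q i f x - c)\<^sup>2) \<partial>measure_iter Q k \<nu>) \<le> ennreal \<delta>)"
        by (intro exI[of _ "\<lambda>k. k \<le> K"]) (simp add: not_le)
    qed
  next
    assume "invariant_measure Q \<nu>"
    then show ?thesis by (rule unif[OF uniformly_ergodic_invariant[OF _ cond2]])
  next
    fix \<mu>
    assume "invariant_measure Q \<mu>" "(\<lambda>n. tv_dist (measure_iter Q n \<nu>) \<mu>) \<longlonglongrightarrow> 0" "bounded (range f)"
      "(\<lambda>n. \<integral>\<^sup>+ x. ennreal ((kernel_fun Q n f x - c)\<^sup>2) \<partial>\<mu>) \<longlonglongrightarrow> 0"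
    then show ?thesis by (rule unif[OF uniformly_ergodic_tv[OF Q \<nu> f _ _ _ _ cond2]])
  next
    fix \<mu> and g :: "'x \<Rightarrow> real" and a :: "nat \<Rightarrow> real"
    let ?c = "\<integral>y. f y \<partial>\<mu>"
    assume "g \<in> borel_measurable borel" "\<forall>x. 0 \<le> g x"
      "(SUP k. \<integral>\<^sup>+ x. ennreal ((g x)\<^sup>2) \<partial>measure_iter Q k \<nu>) < \<infinity>" "\<forall>n. 0 < a n" "a \<longlonglongrightarrow> 0"
      "\<forall>n x. integrable (kernel_pow Q n x) f \<longrightarrow> \<bar>kernel_fun Q n f x - ?c\<bar> \<le> a n * g x"
    then have *: "uniformly_ergodic Q \<nu> f ?c"
      by (intro uniformly_ergodic_dominated[OF Q \<nu> f fin, of g a]) auto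
    \<comment> \<open>Domination yields decay around the \<open>\<mu>\<close>-mean of
      \<open>f\<close>; the second assumption at generation 0 shows that this mean is
      \<open>c\<close>.\<close>
    have "c = ?c" by (rule uniformly_ergodic_limit_unique[OF Q \<nu> f * cond2])
    then show ?thesis using unif * by simp
  qed
qed

end
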